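(* Let $0<\rho<1$. For every complex number $y$ with $|y|\le\rho$ and every integer $n>2$, \[\sum_{f\in \mathbf{A}_n}y^{\Omega(f)}=\prod_P\left(1-\frac{1}{|P|}\right)^{y}\left(1-\frac{y}{|P|}\right)^{-1}\frac{\kappa_n(y)\, q^{n}}{\Gamma(y)\,n^{1-y}}+O\!\left(\frac{q^{n}}{n^{2-\mathrm{Re}(y)}}\right),\] where the implied constant depends only on $q$ and $\rho$.
   Context: $q$ is a fixed prime power, $\mathbb{F}_q$ the finite field with $q$ elements, and $\mathbf{A}=\mathbb{F}_q[T]$. For nonzero $f\in\mathbf{A}$, $|f|=q^{\deg f}$. $\mathbf{A}_n$ is the set of monic polynomials of degree $n$ in $\mathbf{A}$. $\Omega(f)$ is the number of monic irreducible factors of $f$ counted with multiplicity (with $0^0=1$). The product $\prod_P$ runs over all monic irreducible $P\in\mathbf{A}$, and $(1-1/|P|)^y=\exp(y\log(1-1/|P|))$ with the real logarithm. $1/\Gamma$ denotes the entire reciprocal Gamma function, and $n^{1-y}=e^{(1-y)\log n}$. $B_1(t)=t-\lfloor t\rfloor-\tfrac12$, and \[\kappa_n(y)=\exp\!\left(-(1-y)\int_{0}^{+\infty}\frac{B_1(t)\,dt}{(n-1+y+t)(n+t)}\right).\] *)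

theory Defs
  imports
    "HOL-Analysis.Analysis"
    "HOL-Computational_Algebra.Computational_Algebra"
begin

text \<open>
  The finite field with q elements is a type \<open>'a\<close> of sort \<open>{finite, field}\<close>, so that
  q is \<open>CARD('a)\<close> and \<open>'a poly\<close> is the polynomial ring A.
\<close>

definition poly_abs :: "'a::{finite,field} poly \<Rightarrow> real" where
  "poly_abs f = (if f = 0 then 0 else real CARD('a) ^ degree f)"

definition monic_of_degree :: "nat \<Rightarrow> 'a::{finite,field} poly set" where
  "monic_of_degree n = {f. degree f = n \<and> lead_coeff f = 1}"

definition monic_irreducibles :: "'a::{finite,field} poly set" where
  "monic_irreducibles = {P. lead_coeff P = 1 \<and> irreducible P}"

text \<open>
  The library's \<open>multiplicity\<close> is not available at this sort (an abstract field is no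
  \<open>normalization_semidom\<close>), so it is written out; for \<open>f \<noteq> 0\<close> both the set of
  divisors and the set of exponents are finite.
\<close>

definition big_Omega :: "'a::{finite,field} poly \<Rightarrow> nat" where
  "big_Omega f = (\<Sum>P\<in>{P\<in>monic_irreducibles. P dvd f}. Max {k. P ^ k dvd f})"

text \<open>
  Unordered infinite product, the limit of the finite subproducts along the net of all finite
  subsets of \<open>S\<close> (the multiplicative analogue of \<open>has_sum\<close> and \<open>infsum\<close>).
  Unlike \<open>has_prod\<close>, a zero limit also counts; the value is unspecified if there is no limit.
\<close>

definition has_unordered_prod :: "('i \<Rightarrow> complex) \<Rightarrow> 'i set \<Rightarrow> complex \<Rightarrow> bool" where
  "has_unordered_prod g S l \<longleftrightarrow> ((\<lambda>F. \<Prod>i\<in>F. g i) \<longlongrightarrow> l) (finite_subsets_at_top S)"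

definition unordered_prod :: "('i \<Rightarrow> complex) \<Rightarrow> 'i set \<Rightarrow> complex" where
  "unordered_prod g S = (THE l. has_unordered_prod g S l)"

definition euler_factor :: "complex \<Rightarrow> 'a::{finite,field} poly \<Rightarrow> complex" where
  "euler_factor y P =
     exp (y * complex_of_real (ln (1 - 1 / poly_abs P))) *
     inverse (1 - y / complex_of_real (poly_abs P))"

definition B1 :: "real \<Rightarrow> real" where
  "B1 t = t - of_int \<lfloor>t\<rfloor> - 1 / 2"

definition kappa :: "nat \<Rightarrow> complex \<Rightarrow> complex" where
  "kappa n y =
     exp (- (1 - y) *
       integral {0..} (\<lambda>t::real. complex_of_real (B1 t) /
         ((of_nat n - 1 + y + of_real t) * (of_nat n + of_real t))))"

end

theory Submission
  imports Defs "HOL-Real_Asymp.Real_Asymp"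
begin

text \<open>
  Write \<open>a n\<close> for the sum of \<open>y ^ big_Omega f\<close> over monic \<open>f\<close> of degree \<open>n\<close>. Taking the logarithmic
  derivative of the Euler product gives \<open>n a n = \<Sum>j=1..n. c j * a (n - j)\<close>, where \<open>c j\<close> is the
  sum of \<open>deg P * y ^ (j / deg P)\<close> over the \<open>P\<close> with \<open>deg P dvd j\<close>. For \<open>y = 1\<close> this forces
  \<open>c j = q ^ j\<close>, and the comparison shows \<open>c j = y q ^ j + O (q ^ (j / 2))\<close> in general. Hence the
  generating function of \<open>a n / q ^ n\<close> is \<open>(1 - z) ^ (- y)\<close> times a power series \<open>G\<close> with
  exponentially decaying coefficients, and \<open>G 1\<close> is the Euler product in the statement. The
  coefficients \<open>d n\<close> of \<open>(1 - z) ^ (- y)\<close> are \<open>n ^ (y - 1) / Gamma y\<close> up to an error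
  \<open>O (n ^ (Re y - 2))\<close> and vary slowly, so the convolution with \<open>G\<close> is \<open>G 1 * d n\<close> up to the allowed
  error. Finally \<open>kappa n y = 1 + O (1 / n)\<close>, so this factor is absorbed by the error term too.
\<close>

subsection \<open>Factorisation of monic polynomials\<close>

lemma monic_of_degree_0: "monic_of_degree 0 = ({1} :: 'a::{finite,field} poly set)"
  by (auto simp: monic_of_degree_def elim!: degree_eq_zeroE)

text \<open>Splitting off the constant coefficient lowers the degree by one and keeps the leading
  coefficient, so finiteness and the count \<open>q ^ n\<close> follow by induction.\<close>

lemma monic_of_degree_Suc:
  "monic_of_degree (Suc n) =
     (\<lambda>(c, p). pCons c p) ` (UNIV \<times> (monic_of_degree n :: 'a::{finite,field} poly set))"
proof (intro set_eqI iffI)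
  fix f :: "'a poly"
  assume f: "f \<in> monic_of_degree (Suc n)"
  obtain c p where fp: "f = pCons c p" by (cases f)
  have "p \<noteq> 0" using f fp by (auto simp: monic_of_degree_def)
  hence "p \<in> monic_of_degree n" using f fp by (auto simp: monic_of_degree_def)
  thus "f \<in> (\<lambda>(c, p). pCons c p) ` (UNIV \<times> monic_of_degree n)" using fp by force
qed (force simp: monic_of_degree_def)

lemma finite_monic_of_degree [simp]: "finite (monic_of_degree n :: 'a::{finite,field} poly set)"
  by (induction n) (auto simp: monic_of_degree_0 monic_of_degree_Suc)

lemma card_monic_of_degree:
  "card (monic_of_degree n :: 'a::{finite,field} poly set) = CARD('a) ^ n"
proof (induction n)
  case (Suc n)
  have "inj_on (\<lambda>(c, p). pCons c p) (UNIV \<times> (monic_of_degree n :: 'a poly set))"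
    by (auto simp: inj_on_def)
  thus ?case by (simp add: monic_of_degree_Suc card_image Suc)
qed (simp add: monic_of_degree_0)

lemma monic_irreducible_degree_pos:
  assumes "P \<in> (monic_irreducibles :: 'a::{finite,field} poly set)"
  shows "degree P > 0"
proof (rule ccontr)
  assume "\<not> degree P > 0"
  hence "P = 1" using assms by (auto simp: monic_irreducibles_def elim!: degree_eq_zeroE)
  thus False using assms by (auto simp: monic_irreducibles_def irreducible_def)
qed

lemma monic_irreducibles_nonzero: "P \<in> monic_irreducibles \<Longrightarrow> P \<noteq> 0"
  by (auto simp: monic_irreducibles_def)

lemma finite_monic_irreducibles_degree_le [simp]:
  "finite {P \<in> (monic_irreducibles :: 'a::{finite,field} poly set). degree P \<le> n}"
proof (rule finite_subset)
  show "{P \<in> (monic_irreducibles :: 'a poly set). degree P \<le> n} \<subseteq> (\<Union>k\<le>n. monic_of_degree k)"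
    by (auto simp: monic_irreducibles_def monic_of_degree_def)
qed auto

lemma finite_monic_irreducibles_degree_dvd:
  "j > 0 \<Longrightarrow> finite {P \<in> (monic_irreducibles :: 'a::{finite,field} poly set). degree P dvd j}"
  by (rule finite_subset[OF _ finite_monic_irreducibles_degree_le[of j]]) (auto dest: dvd_imp_le)

text \<open>The cofactor is a unit, hence a constant, and comparing leading coefficients forces this
  constant to be 1.\<close>

lemma monic_irreducible_dvd_imp_eq:
  assumes "P \<in> (monic_irreducibles :: 'a::{finite,field} poly set)" "Q \<in> monic_irreducibles" "Q dvd P"
  shows "Q = P"
proof -
  obtain R where R: "P = Q * R" using assms(3) by blast
  have "irreducible P" and "\<not> is_unit Q"
    using assms by (auto simp: monic_irreducibles_def irreducible_def)
  hence "is_unit R" using irreducibleD[OF _ R] by blast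
  then obtain c where c: "R = [:c:]" by (auto elim!: is_unit_polyE)
  have "lead_coeff P = lead_coeff Q * c" by (simp add: R c lead_coeff_mult)
  hence "c = 1" using assms by (simp add: monic_irreducibles_def)
  thus ?thesis using R c by simp
qed

section \<open>Exponents of irreducible factors\<close>

abbreviation poly_exponent :: "'a::{finite,field} poly \<Rightarrow> 'a poly \<Rightarrow> nat" where
  "poly_exponent P f \<equiv> Max {k. P ^ k dvd f}"

text \<open>Since \<open>degree P > 0\<close>, admissible exponents are at most
  \<open>degree f\<close>; the \<open>Max\<close> is therefore over a finite nonempty set, which is
  closed downwards. All later use of the \<open>Max\<close> goes through this equivalence.\<close>

lemma power_dvd_iff_le_exponent:
  assumes P: "P \<in> (monic_irreducibles :: 'a::{finite,field} poly set)" and f: "f \<noteq> 0"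
  shows "P ^ k dvd f \<longleftrightarrow> k \<le> poly_exponent P f"
proof -
  have "k \<le> degree f" if "P ^ k dvd f" for k
  proof -
    have "k * degree P \<le> degree f"
      using dvd_imp_degree_le[OF that f] monic_irreducibles_nonzero[OF P]
      by (simp add: degree_power_eq)
    moreover have "k * 1 \<le> k * degree P"
      using monic_irreducible_degree_pos[OF P] by (intro mult_le_mono2) simp
    ultimately show ?thesis by linarith
  qed
  hence fin: "finite {k. P ^ k dvd f}" by (rule_tac finite_subset[of _ "{..degree f}"]) auto
  have ne: "0 \<in> {k. P ^ k dvd f}" by simp
  show ?thesis
  proof
    assume "k \<le> poly_exponent P f"
    moreover have "poly_exponent P f \<in> {k. P ^ k dvd f}" using Max_in[OF fin] ne by blast
    ultimately show "P ^ k dvd f" by (auto intro: dvd_trans[OF le_imp_power_dvd])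
  qed (use Max_ge[OF fin] in auto)
qed

text \<open>Induction on \<open>k\<close>: the prime \<open>Q\<close> cannot divide
  \<open>P\<close>, so it divides \<open>g\<close>, and one factor \<open>Q\<close> cancels on both
  sides.\<close>

lemma irreducible_power_dvd_mult_cancel:
  assumes P: "P \<in> (monic_irreducibles :: 'a::{finite,field} poly set)"
    and Q: "Q \<in> monic_irreducibles" and "Q \<noteq> P"
  shows "Q ^ k dvd P * g \<Longrightarrow> Q ^ k dvd g"
proof (induction k arbitrary: g)
  case (Suc k)
  have prime: "prime_elem Q"
    using Q by (intro field_poly_irreducible_imp_prime) (auto simp: monic_irreducibles_def)
  have "Q dvd P * g" using Suc.prems by (auto intro: dvd_trans[of _ "Q ^ Suc k"])
  hence "Q dvd g"
    using monic_irreducible_dvd_imp_eq[OF P Q] assms(3) prime by (auto dest: prime_elem_dvd_multD)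
  then obtain h where h: "g = Q * h" by blast
  have "Q * Q ^ k dvd Q * (P * h)" using Suc.prems by (simp add: h mult_ac)
  hence "Q ^ k dvd P * h" using monic_irreducibles_nonzero[OF Q] by simp
  from Suc.IH[OF this] show ?case using h by simp
qed simp

lemma poly_exponent_mult:
  assumes P: "P \<in> (monic_irreducibles :: 'a::{finite,field} poly set)"
    and Q: "Q \<in> monic_irreducibles" and g: "g \<noteq> 0"
  shows "poly_exponent Q (P * g) = poly_exponent Q g + (if Q = P then 1 else 0)"
proof -
  have Pg: "P * g \<noteq> 0" using g monic_irreducibles_nonzero[OF P] by simp
  \<comment> \<open>Two naturals with the same lower bounds are equal; this form turns the claim
    into one about divisibility by powers of \<open>Q\<close>.\<close>
  have "k \<le> poly_exponent Q (P * g) \<longleftrightarrow> k \<le> poly_exponent Q g + (if Q = P then 1 else 0)" for k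
  proof (cases "Q = P")
    case True
    show ?thesis
    proof (cases k)
      case (Suc l)
      have "k \<le> poly_exponent Q (P * g) \<longleftrightarrow> Q * Q ^ l dvd Q * g"
        using power_dvd_iff_le_exponent[OF Q Pg, of k] True Suc by simp
      also have "\<dots> \<longleftrightarrow> Q ^ l dvd g" using monic_irreducibles_nonzero[OF Q] by simp
      finally show ?thesis using power_dvd_iff_le_exponent[OF Q g, of l] True Suc by simp
    qed simp
  next
    case False
    have "k \<le> poly_exponent Q (P * g) \<longleftrightarrow> k \<le> poly_exponent Q g"
      using irreducible_power_dvd_mult_cancel[OF P Q False] dvd_mult
        power_dvd_iff_le_exponent[OF Q Pg, of k] power_dvd_iff_le_exponent[OF Q g, of k] by blast
    thus ?thesis using False by simp
  qed
  thus ?thesis by (meson eq_iff)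
qed

text \<open>The weight \<open>w\<close> serves two purposes: \<open>w = 1\<close> yields additivity
  of \<open>big_Omega\<close>, and \<open>w = degree\<close> yields the formula for the
  degree.\<close>

lemma sum_poly_exponent_mult:
  fixes w :: "'a::{finite,field} poly \<Rightarrow> nat"
  assumes P: "P \<in> monic_irreducibles" and g: "g \<noteq> 0"
  shows "(\<Sum>Q\<in>{Q\<in>monic_irreducibles. Q dvd P * g}. w Q * poly_exponent Q (P * g)) =
         w P + (\<Sum>Q\<in>{Q\<in>monic_irreducibles. Q dvd g}. w Q * poly_exponent Q g)"
proof -
  let ?N = "{Q \<in> (monic_irreducibles :: 'a poly set). degree Q \<le> degree (P * g)}"
  have Pg: "P * g \<noteq> 0" using g monic_irreducibles_nonzero[OF P] by simp
  have deg: "degree g \<le> degree (P * g)" "degree P \<le> degree (P * g)"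
    using g monic_irreducibles_nonzero[OF P] by (simp_all add: degree_mult_eq)
  \<comment> \<open>The divisors of \<open>g\<close> and of \<open>P * g\<close> form different
    index sets. Both sums are moved to the common set \<open>?N\<close>, where an irreducible that
    does not divide has exponent 0.\<close>
  have ext: "(\<Sum>Q\<in>{Q\<in>monic_irreducibles. Q dvd h}. w Q * poly_exponent Q h) =
             (\<Sum>Q\<in>?N. w Q * poly_exponent Q h)"
    if "h \<noteq> 0" "degree h \<le> degree (P * g)" for h
  proof (rule sum.mono_neutral_left)
    show "\<forall>Q\<in>?N - {Q \<in> monic_irreducibles. Q dvd h}. w Q * poly_exponent Q h = 0"
    proof
      fix Q assume Q: "Q \<in> ?N - {Q \<in> monic_irreducibles. Q dvd h}"
      hence "\<not> 1 \<le> poly_exponent Q h"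
        using power_dvd_iff_le_exponent[of Q h 1] that by auto
      thus "w Q * poly_exponent Q h = 0" by simp
    qed
  qed (use that in \<open>auto dest: dvd_imp_degree_le\<close>)
  have "(\<Sum>Q\<in>{Q\<in>monic_irreducibles. Q dvd P * g}. w Q * poly_exponent Q (P * g)) =
        (\<Sum>Q\<in>?N. w Q * poly_exponent Q (P * g))"
    by (rule ext[OF Pg]) simp
  also have "\<dots> = (\<Sum>Q\<in>?N. w Q * poly_exponent Q g + (if Q = P then w Q else 0))"
    by (intro sum.cong refl) (simp add: poly_exponent_mult[OF P _ g] add_mult_distrib2)
  also have "\<dots> = (\<Sum>Q\<in>?N. w Q * poly_exponent Q g) + w P"
    using P deg by (simp add: sum.distrib)
  finally show ?thesis using ext[OF g deg(1)] by simp
qed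

lemma big_Omega_mult:
  assumes "P \<in> monic_irreducibles" and "g \<noteq> 0"
  shows "big_Omega (P * g) = Suc (big_Omega g)"
  using sum_poly_exponent_mult[OF assms, of "\<lambda>_. 1"] by (simp add: big_Omega_def)

lemma big_Omega_power_mult:
  assumes "P \<in> monic_irreducibles" and "g \<noteq> 0"
  shows "big_Omega (P ^ k * g) = k + big_Omega g"
  using assms monic_irreducibles_nonzero[OF assms(1)]
  by (induction k) (auto simp: mult.assoc big_Omega_mult)

text \<open>Strong induction on the degree: an irreducible \<open>f\<close> is made monic by
  scaling, and a reducible one has a factor of smaller positive degree.\<close>

lemma monic_irreducible_factor_exists:
  fixes f :: "'a::{finite,field} poly"
  assumes "degree f > 0"
  shows "\<exists>P\<in>monic_irreducibles. P dvd f"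
  using assms
proof (induction "degree f" arbitrary: f rule: less_induct)
  case less
  show ?case
  proof (cases "irreducible f")
    case True
    define c where "c = inverse (lead_coeff f)"
    have f0: "f \<noteq> 0" using less.prems by auto
    hence c: "c \<noteq> 0" by (simp add: c_def)
    have "irreducible (smult c f)"
      using True c irreducible_mult_unit_left[of "[:c:]" f]
      by (simp add: is_unit_const_poly_iff dvd_field_iff)
    moreover have "lead_coeff (smult c f) = 1" using f0 by (simp add: c_def)
    moreover have "smult c f dvd f" using c by (simp add: smult_dvd_iff)
    ultimately show ?thesis unfolding monic_irreducibles_def by blast
  next
    case False
    have "f \<noteq> 0" using less.prems by auto
    moreover have "\<not> f dvd 1" using less.prems \<open>f \<noteq> 0\<close> by (simp add: is_unit_iff_degree)
    ultimately obtain a b where ab: "f = a * b" "\<not> a dvd 1" "\<not> b dvd 1"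
      using False unfolding irreducible_def by blast
    have nz: "a \<noteq> 0" "b \<noteq> 0" using ab \<open>f \<noteq> 0\<close> by auto
    hence d: "degree a > 0" "degree b > 0" using ab by (auto simp: is_unit_iff_degree)
    hence "degree a < degree f" using nz by (simp add: ab degree_mult_eq)
    from less.hyps[OF this d(1)] show ?thesis using ab(1) by (auto intro: dvd_mult2)
  qed
qed

lemma degree_eq_sum_exponents:
  fixes f :: "'a::{finite,field} poly"
  assumes "f \<noteq> 0"
  shows "(\<Sum>P\<in>{P\<in>monic_irreducibles. P dvd f}. degree P * poly_exponent P f) = degree f"
  using assms
proof (induction "degree f" arbitrary: f rule: less_induct)
  case less
  show ?case
  proof (cases "degree f = 0")
    case True
    have "\<not> P dvd f" if "P \<in> monic_irreducibles" for P
      using dvd_imp_degree_le[OF _ less.prems, of P] monic_irreducible_degree_pos[OF that] True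
      by auto
    thus ?thesis using True by (intro trans[OF sum.neutral]) auto
  next
    case False
    then obtain P g where P: "P \<in> monic_irreducibles" and fg: "f = P * g"
      using monic_irreducible_factor_exists[of f] by (auto elim!: dvdE)
    have nz: "P \<noteq> 0" "g \<noteq> 0" using less.prems fg by auto
    have "degree g < degree f"
      using monic_irreducible_degree_pos[OF P] nz by (simp add: fg degree_mult_eq)
    from less.hyps[OF this nz(2)] show ?thesis
      using sum_poly_exponent_mult[OF P nz(2), of degree] nz by (simp add: fg degree_mult_eq)
  qed
qed

section \<open>The sums over monic polynomials and their recurrence\<close>

definition Omega_sum :: "'a::{finite,field} itself \<Rightarrow> complex \<Rightarrow> nat \<Rightarrow> complex" where
  "Omega_sum _ y n = (\<Sum>f\<in>(monic_of_degree n :: 'a poly set). y ^ big_Omega f)"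

text \<open>The coefficient of \<open>z ^ j\<close> in \<open>z * F' / F\<close> for
  \<open>j > 0\<close>, where \<open>F\<close> is the formal product of
  \<open>1 / (1 - y * z ^ degree P)\<close> over all \<open>P\<close>.\<close>

definition irred_sum :: "'a::{finite,field} itself \<Rightarrow> complex \<Rightarrow> nat \<Rightarrow> complex" where
  "irred_sum _ y j = (\<Sum>P\<in>{P\<in>(monic_irreducibles :: 'a poly set). degree P dvd j}.
     of_nat (degree P) * y ^ (j div degree P))"

text \<open>Logarithmic derivative of the Euler product, coefficientwise.\<close>

lemma Omega_sum_recurrence:
  fixes T :: "'a::{finite,field} itself"
  shows "of_nat n * Omega_sum T y n = (\<Sum>j\<in>{1..n}. irred_sum T y j * Omega_sum T y (n - j))"
proof -
  let ?I = "monic_irreducibles :: 'a poly set"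
  let ?L = "SIGMA f:monic_of_degree n. SIGMA P:{P\<in>?I. P dvd f}. {1..poly_exponent P f}"
  let ?R = "SIGMA j:{1..n}. SIGMA P:{P\<in>?I. degree P dvd j}. (monic_of_degree (n - j) :: 'a poly set)"
  have nz: "f \<noteq> 0" if "f \<in> monic_of_degree m" for f :: "'a poly" and m
    using that by (auto simp: monic_of_degree_def)
  have finD: "finite {P \<in> ?I. P dvd f}" if "f \<in> monic_of_degree n" for f
    by (rule finite_subset[OF _ finite_monic_irreducibles_degree_le[of "degree f"]])
       (use nz[OF that] in \<open>auto dest: dvd_imp_degree_le\<close>)
  have finJ: "finite {P \<in> ?I. degree P dvd j}" if "j \<in> {1..n}" for j
    using finite_monic_irreducibles_degree_dvd[of j] that by simp
  have "of_nat n * Omega_sum T y n = (\<Sum>f\<in>(monic_of_degree n :: 'a poly set). of_nat (degree f) * y ^ big_Omega f)"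
    unfolding Omega_sum_def sum_distrib_left by (intro sum.cong) (auto simp: monic_of_degree_def)
  \<comment> \<open>The degree of \<open>f\<close> is the sum of \<open>degree P\<close> over all
    pairs \<open>(P, k)\<close> with \<open>k \<ge> 1\<close> and \<open>P ^ k dvd f\<close>,
    because an exponent counts such \<open>k\<close>.\<close>
  also have "\<dots> = (\<Sum>f\<in>monic_of_degree n. \<Sum>P\<in>{P\<in>?I. P dvd f}. \<Sum>k\<in>{1..poly_exponent P f}.
                 of_nat (degree P) * y ^ big_Omega f)"
  proof (intro sum.cong refl)
    fix f :: "'a poly" assume "f \<in> monic_of_degree n"
    hence "of_nat (degree f) * y ^ big_Omega f =
      of_nat (\<Sum>P\<in>{P\<in>monic_irreducibles. P dvd f}. degree P * poly_exponent P f) * y ^ big_Omega f"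
      using degree_eq_sum_exponents[OF nz] by simp
    thus "of_nat (degree f) * y ^ big_Omega f = (\<Sum>P\<in>{P\<in>?I. P dvd f}. \<Sum>k\<in>{1..poly_exponent P f}.
                 of_nat (degree P) * y ^ big_Omega f)"
      by (simp add: sum_distrib_right sum_distrib_left mult_ac)
  qed
  also have "\<dots> = (\<Sum>f\<in>monic_of_degree n. \<Sum>(P, k)\<in>Sigma {P\<in>?I. P dvd f} (\<lambda>P. {1..poly_exponent P f}).
                 of_nat (degree P) * y ^ big_Omega f)"
    using finD by (intro sum.cong refl sum.Sigma) auto
  also have "\<dots> = (\<Sum>(f, P, k)\<in>?L. of_nat (degree P) * y ^ big_Omega f)"
    using finD by (intro sum.Sigma) auto
  \<comment> \<open>Writing \<open>f = P ^ k * g\<close> and \<open>j = k * degree P\<close> is a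
    bijection of the index sets; \<open>big_Omega f = k + big_Omega g\<close> splits the power of
    \<open>y\<close>.\<close>
  also have "\<dots> = (\<Sum>(j, P, g)\<in>?R. of_nat (degree P) * y ^ (j div degree P) * y ^ big_Omega g)"
  proof (rule sum.reindex_bij_witness[where
      i = "\<lambda>(j, P, g). (P ^ (j div degree P) * g, P, j div degree P)" and
      j = "\<lambda>(f, P, k). (k * degree P, P, f div P ^ k)"])
    fix x assume x: "x \<in> ?L"
    obtain f P k where fPk: "x = (f, P, k)" by (cases x)
    have f: "f \<in> monic_of_degree n" and P: "P \<in> ?I" and k: "k \<ge> 1" "k \<le> poly_exponent P f"
      using x fPk by auto
    have nzf: "f \<noteq> 0" and nzP: "P \<noteq> 0"
      using nz f monic_irreducibles_nonzero P by auto
    have "P ^ k dvd f" using power_dvd_iff_le_exponent[OF P nzf, of k] k by blast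
    then obtain g where g: "f = P ^ k * g" by blast
    have nzg: "g \<noteq> 0" using nzf g by auto
    have gdiv: "f div P ^ k = g" using g nzP by simp
    have deg: "n = k * degree P + degree g"
      using f nzP nzg by (auto simp: monic_of_degree_def g degree_mult_eq degree_power_eq)
    have lead: "lead_coeff g = 1"
      using f P by (auto simp: monic_of_degree_def monic_irreducibles_def g lead_coeff_mult lead_coeff_power)
    have dP: "degree P > 0" by (rule monic_irreducible_degree_pos[OF P])
    show "(case (case x of (f, P, k) \<Rightarrow> (k * degree P, P, f div P ^ k)) of
        (j, P, g) \<Rightarrow> (P ^ (j div degree P) * g, P, j div degree P)) = x"
      using dP by (simp add: fPk gdiv) (simp add: g)
    show "(case x of (f, P, k) \<Rightarrow> (k * degree P, P, f div P ^ k)) \<in> ?R"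
      using dP deg lead k P by (auto simp: fPk gdiv monic_of_degree_def)
    show "(case case x of (f, P, k) \<Rightarrow> (k * degree P, P, f div P ^ k) of
        (j, P, g) \<Rightarrow> of_nat (degree P) * y ^ (j div degree P) * y ^ big_Omega g) =
      (case x of (f, P, k) \<Rightarrow> of_nat (degree P) * y ^ big_Omega f)"
      using dP by (simp add: fPk gdiv) (simp add: g big_Omega_power_mult[OF P nzg] power_add)
  next
    fix x assume x: "x \<in> ?R"
    obtain j P g where jPg: "x = (j, P, g)" by (cases x)
    have g: "g \<in> monic_of_degree (n - j)" and P: "P \<in> ?I" and j: "1 \<le> j" "j \<le> n" "degree P dvd j"
      using x jPg by auto
    define k where "k = j div degree P"
    have jk: "j = k * degree P" using j by (simp add: k_def)
    have k: "k \<ge> 1" using jk j by (cases k) auto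
    have nzg: "g \<noteq> 0" and nzP: "P \<noteq> 0"
      using nz g monic_irreducibles_nonzero P by auto
    have dP: "degree P > 0" by (rule monic_irreducible_degree_pos[OF P])
    have "degree (P ^ k * g) = n"
      using g nzg nzP j jk by (auto simp: monic_of_degree_def degree_mult_eq degree_power_eq)
    moreover have "lead_coeff (P ^ k * g) = 1"
      using g P unfolding lead_coeff_mult lead_coeff_power
      by (auto simp: monic_of_degree_def monic_irreducibles_def)
    ultimately have mem: "P ^ k * g \<in> monic_of_degree n" by (simp add: monic_of_degree_def)
    show "(case (case x of (j, P, g) \<Rightarrow> (P ^ (j div degree P) * g, P, j div degree P)) of
        (f, P, k) \<Rightarrow> (k * degree P, P, f div P ^ k)) = x"
      using nzP j by (simp add: jPg)
    have "k \<le> poly_exponent P (P ^ k * g)"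
      using power_dvd_iff_le_exponent[OF P, of "P ^ k * g" k] nzP nzg dvd_triv_left no_zero_divisors
        power_not_zero by blast
    moreover have "P dvd P ^ k * g" using k by (simp add: dvd_power)
    ultimately show "(case x of (j, P, g) \<Rightarrow> (P ^ (j div degree P) * g, P, j div degree P)) \<in> ?L"
      using mem P k by (simp add: jPg flip: k_def)
  qed
  also have "\<dots> = (\<Sum>j\<in>{1..n}. \<Sum>P\<in>{P\<in>?I. degree P dvd j}. \<Sum>g\<in>(monic_of_degree (n - j) :: 'a poly set).
                     of_nat (degree P) * y ^ (j div degree P) * y ^ big_Omega g)"
  proof -
    let ?h = "\<lambda>j P g. of_nat (degree P) * y ^ (j div degree P) * y ^ big_Omega (g :: 'a poly)"
    have "(\<Sum>j\<in>{1..n}. \<Sum>P\<in>{P\<in>?I. degree P dvd j}. \<Sum>g\<in>monic_of_degree (n - j). ?h j P g) =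
          (\<Sum>j\<in>{1..n}. \<Sum>(P, g)\<in>Sigma {P\<in>?I. degree P dvd j} (\<lambda>_. monic_of_degree (n - j)). ?h j P g)"
      using finJ by (intro sum.cong refl sum.Sigma) auto
    also have "\<dots> = (\<Sum>(j, P, g)\<in>?R. ?h j P g)"
      using finJ by (intro sum.Sigma) auto
    finally show ?thesis by (rule sym)
  qed
  also have "\<dots> = (\<Sum>j\<in>{1..n}. irred_sum T y j * Omega_sum T y (n - j))"
    by (simp add: irred_sum_def Omega_sum_def sum_product)
  finally show ?thesis .
qed

lemma Omega_sum_0: "Omega_sum (T :: 'a::{finite,field} itself) y 0 = 1"
proof -
  have "{P\<in>(monic_irreducibles :: 'a poly set). P dvd 1} = {}"
    by (auto simp: monic_irreducibles_def irreducible_def)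
  hence "big_Omega (1 :: 'a poly) = 0" by (simp add: big_Omega_def del: Collect_empty_eq)
  thus ?thesis by (simp add: Omega_sum_def monic_of_degree_0)
qed

text \<open>For \<open>y = 1\<close> every \<open>Omega_sum\<close> is a power of \<open>q\<close>.
  Subtracting \<open>q\<close> times the recurrence at \<open>m\<close> from the one at
  \<open>Suc m\<close> isolates the last term. This is the exact prime polynomial theorem, the sum
  of \<open>degree P\<close> over \<open>degree P dvd j\<close>.\<close>

lemma irred_sum_1:
  assumes "j > 0"
  shows "irred_sum (T :: 'a::{finite,field} itself) 1 j = of_nat CARD('a) ^ j"
proof -
  let ?q = "of_nat CARD('a) :: complex"
  obtain m where m: "j = Suc m" using assms by (cases j) auto
  have a: "Omega_sum T 1 n = ?q ^ n" for n
    by (simp add: Omega_sum_def card_monic_of_degree)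
  have "of_nat (Suc m) * ?q ^ Suc m = (\<Sum>i\<in>{1..Suc m}. irred_sum T 1 i * ?q ^ (Suc m - i))"
    using Omega_sum_recurrence[of "Suc m" T 1] by (simp add: a)
  also have "\<dots> = (\<Sum>i\<in>{1..m}. irred_sum T 1 i * ?q ^ (Suc m - i)) + irred_sum T 1 (Suc m)"
    by simp
  also have "(\<Sum>i\<in>{1..m}. irred_sum T 1 i * ?q ^ (Suc m - i)) =
             ?q * (\<Sum>i\<in>{1..m}. irred_sum T 1 i * ?q ^ (m - i))"
    unfolding sum_distrib_left by (intro sum.cong refl) (auto simp: Suc_diff_le)
  also have "\<dots> = of_nat m * ?q ^ Suc m"
    using Omega_sum_recurrence[of m T 1] by (simp add: a)
  finally show ?thesis by (simp add: m algebra_simps)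
qed

subsection \<open>Coefficients of the negative binomial series\<close>

text \<open>The coefficient of \<open>z ^ n\<close> in \<open>(1 - z) ^ (- y)\<close>.\<close>

definition neg_binom :: "complex \<Rightarrow> nat \<Rightarrow> complex" where
  "neg_binom y n = pochhammer y n / fact n"

lemma neg_binom_0 [simp]: "neg_binom y 0 = 1"
  by (simp add: neg_binom_def)

lemma neg_binom_Suc: "neg_binom y (Suc n) = neg_binom y n * (y + of_nat n) / of_nat (Suc n)"
  by (simp add: neg_binom_def pochhammer_Suc)

text \<open>Consecutive coefficients differ by a factor of order \<open>1 / n\<close> less than
  their size; this is the slow variation needed for the convolution.\<close>

lemma neg_binom_diff:
  "neg_binom y (Suc n) - neg_binom y n = neg_binom y n * (y - 1) / of_nat (Suc n)"
proof -
  have "of_nat (Suc n) \<noteq> (0 :: complex)" by (simp only: of_nat_eq_0_iff)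
  thus ?thesis by (simp add: neg_binom_Suc field_simps)
qed

lemma norm_neg_binom_le_1:
  assumes "norm y \<le> 1"
  shows "norm (neg_binom y n) \<le> 1"
proof (induction n)
  case (Suc n)
  have "norm (y + of_nat n) \<le> 1 + real n"
    using norm_triangle_ineq[of y "of_nat n"] assms by simp
  hence "norm (neg_binom y n) * norm (y + of_nat n) \<le> 1 * (1 + real n)"
    using Suc by (intro mult_mono) auto
  moreover have "norm (neg_binom y (Suc n)) = norm (neg_binom y n) * norm (y + of_nat n) / real (Suc n)"
    by (simp only: neg_binom_Suc norm_mult norm_divide norm_of_nat)
  ultimately show ?case by simp
qed simp

text \<open>The same type of recurrence as for \<open>Omega_sum\<close>, with all logarithmic
  derivative coefficients equal to \<open>y\<close>, since
  \<open>z * D' = y * z / (1 - z) * D\<close> for \<open>D = (1 - z) ^ (- y)\<close>.\<close>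

lemma neg_binom_sum:
  "of_nat n * neg_binom y n = y * (\<Sum>j\<in>{1..n}. neg_binom y (n - j))"
proof (induction n)
  case (Suc n)
  have *: "(\<Sum>j\<in>{1..Suc n}. neg_binom y (Suc n - j)) = neg_binom y n + (\<Sum>j\<in>{1..n}. neg_binom y (n - j))"
  proof -
    have "(\<Sum>j\<in>{1..Suc n}. neg_binom y (Suc n - j)) = (\<Sum>j\<in>{0..n}. neg_binom y (n - j))"
      using sum.shift_bounds_cl_Suc_ivl[of "\<lambda>j. neg_binom y (Suc n - j)" 0 n] by simp
    thus ?thesis by (simp add: sum.atLeast_Suc_atMost)
  qed
  have "of_nat (Suc n) * neg_binom y (Suc n) = neg_binom y n * (y + of_nat n)"
    by (simp add: neg_binom_Suc field_simps del: of_nat_Suc)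
  also have "\<dots> = y * (neg_binom y n + (\<Sum>j\<in>{1..n}. neg_binom y (n - j)))"
    using Suc by (simp add: algebra_simps)
  finally show ?case unfolding * .
qed simp

lemma ln_1_plus_inverse_bounds:
  assumes "m \<ge> (1 :: real)"
  shows "ln (1 + 1 / m) \<le> 1 / m" "1 / (m + 1) \<le> ln (1 + 1 / m)"
proof -
  show "ln (1 + 1 / m) \<le> 1 / m" using assms by (intro ln_add_one_self_le_self) auto
  have "ln (m / (m + 1)) \<le> m / (m + 1) - 1" using assms by (intro ln_le_minus_one) auto
  also have "m / (m + 1) - 1 = - (1 / (m + 1))" using assms by (simp add: field_simps)
  also have "ln (m / (m + 1)) = - ln (1 + 1 / m)"
    using assms by (subst ln_inverse[symmetric]) (auto simp: field_simps)
  finally show "1 / (m + 1) \<le> ln (1 + 1 / m)" by simp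
qed

text \<open>The expression is the relative increment of
  \<open>neg_binom y m * m powr (1 - y)\<close> from \<open>m\<close> to \<open>m + 1\<close>. The
  first factor is \<open>1 - s\<close>, the second is \<open>1 + t\<close> up to a quadratic error,
  and \<open>s\<close> and \<open>t\<close> agree to first order.\<close>

lemma neg_binom_ratio_bound:
  fixes y :: complex and m :: real
  assumes y: "norm y \<le> 1" and m: "m \<ge> 1"
  shows "norm ((of_real m + y) / (of_real m + 1) * exp ((1 - y) * of_real (ln (1 + 1 / m))) - 1)
           \<le> (6 + 4 * exp 2) / m ^ 2"
proof -
  define l where "l = ln (1 + 1 / m)"
  define s where "s = (1 - y) / (of_real m + 1)"
  define t where "t = (1 - y) * of_real l"
  define r where "r = exp t - (1 + t)"
  have l: "1 / (m + 1) \<le> l" "l \<le> 1 / m" "0 \<le> l"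
    using ln_1_plus_inverse_bounds[OF m] m by (auto simp: l_def)
  have y2: "norm (1 - y) \<le> 2" using norm_triangle_ineq4[of 1 y] y by simp
  have nm: "norm (of_real m + 1 :: complex) = m + 1"
    using m by (metis abs_of_nonneg add_nonneg_nonneg norm_of_real of_real_1 of_real_add
        order_trans zero_le_one)
  have m1: "of_real m + 1 \<noteq> (0 :: complex)"
  proof
    assume "of_real m + 1 = (0 :: complex)"
    hence "m + 1 = norm (0 :: complex)" using nm by simp
    thus False using m by simp
  qed
  have t: "norm t \<le> 2 / m"
    using mult_mono[OF y2 l(2)] l(3) m by (simp add: t_def norm_mult)
  have s: "norm s \<le> 2 / m"
  proof -
    have "norm s = norm (1 - y) / (m + 1)" by (simp only: s_def norm_divide nm)
    also have "\<dots> \<le> 2 / m" using y2 m by (intro frac_le) auto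
    finally show ?thesis .
  qed
  have ts: "norm (t - s) \<le> 2 / m ^ 2"
  proof -
    have "t - s = (1 - y) * of_real (l - 1 / (m + 1))"
      using m1 by (simp add: t_def s_def algebra_simps)
    hence "norm (t - s) = norm (1 - y) * (l - 1 / (m + 1))"
      using l by (simp add: norm_mult del: of_real_diff)
    also have "\<dots> \<le> 2 * (1 / m - 1 / (m + 1))" using y2 l by (intro mult_mono) auto
    also have "1 / m - 1 / (m + 1) = 1 / (m * (m + 1))" using m by (simp add: field_simps)
    also have "2 * (1 / (m * (m + 1))) \<le> 2 * (1 / m ^ 2)"
      using m by (intro mult_left_mono frac_le) (auto simp: power2_eq_square)
    finally show ?thesis by simp
  qed
  have r: "norm r \<le> 4 * exp 2 / m ^ 2"
  proof -
    have "norm t \<le> 2" using order_trans[OF t, of 2] m by (simp add: field_simps)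
    have "norm r \<le> exp (norm t) * norm t ^ 2"
      using Taylor_exp_field[of t 1] by (simp add: r_def power2_eq_square)
    also have "\<dots> \<le> exp 2 * (2 / m) ^ 2"
      using t \<open>norm t \<le> 2\<close> by (intro mult_mono power_mono) auto
    finally show ?thesis by (simp add: power_divide mult.commute)
  qed
  have s1: "norm (1 - s) \<le> 1"
  proof -
    have "1 - s = (of_real m + y) / (of_real m + 1)" using m1 by (simp add: s_def field_simps)
    moreover have "norm (of_real m + y) \<le> m + 1" using norm_triangle_ineq[of "of_real m" y] y m by simp
    ultimately show ?thesis using m by (simp only: norm_divide nm) simp
  qed
  have "(of_real m + y) / (of_real m + 1) * exp ((1 - y) * of_real (ln (1 + 1 / m))) - 1 =
        (1 - s) * (1 + t + r) - 1"
  proof -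
    have "(of_real m + y) / (of_real m + 1) = 1 - s" using m1 by (simp add: s_def field_simps)
    moreover have "exp ((1 - y) * of_real (ln (1 + 1 / m))) = 1 + t + r"
      by (simp add: r_def t_def l_def)
    ultimately show ?thesis by simp
  qed
  \<comment> \<open>The three parts contribute \<open>2\<close>, \<open>4\<close> and
    \<open>4 * exp 2\<close> to the constant.\<close>
  also have "\<dots> = (t - s) - s * t + r * (1 - s)" by (simp add: algebra_simps)
  also have "norm \<dots> \<le> norm (t - s) + norm s * norm t + norm r * norm (1 - s)"
    using norm_triangle_ineq[of "(t - s) - s * t" "r * (1 - s)"] norm_triangle_ineq4[of "t - s" "s * t"]
    by (simp add: norm_mult)
  also have "\<dots> \<le> 2 / m ^ 2 + (2 / m) * (2 / m) + 4 * exp 2 / m ^ 2 * 1"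
    using ts s t r s1 m by (intro add_mono mult_mono) auto
  also have "\<dots> = (6 + 4 * exp 2) / m ^ 2" by (simp add: power2_eq_square add_divide_distrib)
  finally show ?thesis .
qed

text \<open>The sequence \<open>rGamma_series\<close> contains one more factor \<open>y + n\<close>
  in its Pochhammer symbol; dividing by \<open>(y + n) / n\<close>, which tends to 1, gives the
  sequence here.\<close>

lemma neg_binom_normalized_limit:
  "(\<lambda>n. neg_binom y n * of_nat n powr (1 - y)) \<longlonglongrightarrow> rGamma y"
proof -
  have "(\<lambda>n. inverse (1 + y * inverse (of_nat n))) \<longlonglongrightarrow> inverse (1 + y * 0)"
    by (intro tendsto_intros lim_inverse_n) auto
  hence lim: "(\<lambda>n. rGamma_series y n * inverse (1 + y * inverse (of_nat n))) \<longlonglongrightarrow> rGamma y * 1"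
    by (intro tendsto_mult rGamma_series_LIMSEQ) simp
  show ?thesis
  proof (rule Lim_transform_eventually)
    show "(\<lambda>n. rGamma_series y n * inverse (1 + y * inverse (of_nat n))) \<longlonglongrightarrow> rGamma y"
      using lim by simp
    show "\<forall>\<^sub>F n in sequentially. rGamma_series y n * inverse (1 + y * inverse (of_nat n)) =
            neg_binom y n * of_nat n powr (1 - y)"
    \<comment> \<open>For \<open>n > norm y\<close> the factor \<open>y + n\<close> is nonzero and
      may be cancelled, even if \<open>y\<close> is a pole of Gamma.\<close>
    proof (rule eventually_mono[OF eventually_gt_at_top[of "nat \<lceil>norm y\<rceil>"]])
      fix n assume "nat \<lceil>norm y\<rceil> < n"
      hence ny: "norm y < real n" by linarith
      hence n: "n > 0" using norm_ge_zero[of y] by (cases n) auto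
      have nz: "y + of_nat n \<noteq> 0"
      proof
        assume "y + of_nat n = 0"
        hence "y = - of_nat n" by (simp add: eq_neg_iff_add_eq_0)
        thus False using ny by simp
      qed
      have pw: "(of_nat n :: complex) powr (1 - y) = of_nat n / exp (y * of_real (ln (real n)))"
        using n by (simp add: powr_def exp_diff left_diff_distrib Ln_of_nat) (simp add: exp_of_real)
      have cancel: "p * s / (f * e) * inverse (s / N) = p / f * (N / e)" if "s \<noteq> 0" for p s f e N :: complex
        using that by simp
      have "1 + y * inverse (of_nat n) = (y + of_nat n) / of_nat n"
        using n by (simp add: field_simps)
      thus "rGamma_series y n * inverse (1 + y * inverse (of_nat n)) =
            neg_binom y n * of_nat n powr (1 - y)"
        using nz cancel[of "y + of_nat n" "pochhammer y n" "fact n" "exp (y * of_real (ln (real n)))" "of_nat n"]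
        unfolding pw rGamma_series_def neg_binom_def by (simp add: pochhammer_Suc)
    qed
  qed
qed

text \<open>The normalised sequence \<open>u\<close> has relative increments of order
  \<open>1 / m ^ 2\<close>, so it is bounded and approaches its limit \<open>rGamma y\<close> at
  rate \<open>1 / n\<close>. All constants are uniform in \<open>y\<close>.\<close>

lemma neg_binom_asymptotics:
  "\<exists>K>0. \<forall>y n. norm y \<le> 1 \<longrightarrow> n \<ge> 1 \<longrightarrow>
     norm (neg_binom y n) \<le> K * real n powr (Re y - 1) \<and>
     norm (neg_binom y n - rGamma y * of_nat n powr (y - 1)) \<le> K * real n powr (Re y - 2)"
proof -
  define K :: real where "K = 6 + 4 * exp 2"
  define M where "M = exp (2 * K)"
  have K: "K > 0" unfolding K_def by (intro add_pos_pos) auto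
  have M: "M > 0" by (simp add: M_def)
  have "norm (neg_binom y n) \<le> (M + 2 * K * M) * real n powr (Re y - 1) \<and>
     norm (neg_binom y n - rGamma y * of_nat n powr (y - 1)) \<le> (M + 2 * K * M) * real n powr (Re y - 2)"
    if y: "norm y \<le> 1" and n: "n \<ge> 1" for y :: complex and n :: nat
  proof -
    define u where "u = (\<lambda>n. neg_binom y n * of_nat n powr (1 - y))"
    \<comment> \<open>The bound \<open>K / m ^ 2\<close> is replaced by a difference of reciprocals
      so that sums over \<open>m\<close> telescope.\<close>
    have step: "norm (u (Suc m) - u m) \<le> norm (u m) * (2 * K * (1 / real m - 1 / real (Suc m)))"
      if m: "m \<ge> 1" for m
    proof -
      have ln: "ln (real (Suc m)) = ln (real m) + ln (1 + 1 / real m)"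
      proof -
        have "real (Suc m) = real m * (1 + 1 / real m)" using m by (simp add: field_simps)
        moreover have "1 + 1 / real m > 0" by (intro add_pos_nonneg) auto
        ultimately show ?thesis using m by (metis ln_mult_pos of_nat_0_less_iff less_le_trans zero_less_one)
      qed
      have "of_nat (Suc m) powr (1 - y) =
            of_nat m powr (1 - y) * exp ((1 - y) * of_real (ln (1 + 1 / real m)))"
        using m ln unfolding powr_def
        by (simp add: Ln_of_nat ring_distribs flip: exp_add del: of_nat_Suc)
      hence "u (Suc m) - u m = u m *
        ((of_real (real m) + y) / (of_real (real m) + 1) * exp ((1 - y) * of_real (ln (1 + 1 / real m))) - 1)"
        by (simp add: u_def neg_binom_Suc algebra_simps)
      hence "norm (u (Suc m) - u m) \<le> norm (u m) * (K / real m ^ 2)"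
        using neg_binom_ratio_bound[OF y, of "real m"] m
        by (simp only: norm_mult K_def) (intro mult_left_mono, auto)
      also have "K / real m ^ 2 \<le> 2 * K * (1 / real m - 1 / real (Suc m))"
      proof -
        have "1 / real m - 1 / real (Suc m) = 1 / (real m * real (Suc m))"
          using m by (simp add: field_simps)
        moreover have "1 / real m ^ 2 \<le> 2 * (1 / (real m * real (Suc m)))"
          proof -
          have "real m * real (Suc m) \<le> real m * (2 * real m)" using m by (intro mult_left_mono) auto
          hence "1 / (real m * (2 * real m)) \<le> 1 / (real m * real (Suc m))"
            using m by (intro frac_le) auto
          thus ?thesis by (simp add: power2_eq_square)
        qed
        ultimately have "1 / real m ^ 2 \<le> 2 * (1 / real m - 1 / real (Suc m))" by simp
        from mult_left_mono[OF this, of K] K show ?thesis by (simp add: mult_ac)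
      qed
      finally show ?thesis by (simp add: mult_left_mono)
    qed
    \<comment> \<open>A discrete Gronwall argument: the factors \<open>1 + ?d \<le> exp ?d\<close>
      multiply to a telescoping exponent, starting from
      \<open>norm (u 1) = norm y \<le> 1\<close>.\<close>
    have uM: "norm (u m) \<le> exp (2 * K * (1 - 1 / real m))" if "m \<ge> 1" for m
      using that
    proof (induction m rule: dec_induct)
      case base
      show ?case using y by (simp add: u_def neg_binom_def)
    next
      case (step m)
      let ?d = "2 * K * (1 / real m - 1 / real (Suc m))"
      have "norm (u (Suc m)) \<le> norm (u m) + norm (u (Suc m) - u m)"
        using norm_triangle_ineq[of "u m" "u (Suc m) - u m"] by simp
      also have "\<dots> \<le> norm (u m) * (1 + ?d)" using \<open>\<And>m. m \<ge> 1 \<Longrightarrow> _\<close>[of m] step.hyps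
        by (simp add: ring_distribs)
      also have "\<dots> \<le> norm (u m) * exp ?d"
        by (intro mult_left_mono exp_ge_add_one_self) auto
      also have "\<dots> \<le> exp (2 * K * (1 - 1 / real m)) * exp ?d"
        using step.IH by (intro mult_right_mono) auto
      also have "\<dots> = exp (2 * K * (1 - 1 / real (Suc m)))"
        by (simp add: ring_distribs flip: exp_add)
      finally show ?case .
    qed
    have uM': "norm (u m) \<le> M" if "m \<ge> 1" for m
    proof -
      have "2 * K * (1 - 1 / real m) \<le> 2 * K * 1" using K that by (intro mult_left_mono) auto
      hence "exp (2 * K * (1 - 1 / real m)) \<le> M" unfolding M_def by simp
      thus ?thesis using uM[OF that] by linarith
    qed
    have tele: "norm (u m - u n) \<le> 2 * K * M * (1 / real n - 1 / real m)" if "m \<ge> n" for m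
      using that
    proof (induction m rule: dec_induct)
      case (step m)
      have m: "m \<ge> 1" using step.hyps n by simp
      have nonneg: "0 \<le> 1 / real m - 1 / real (Suc m)" using m by (simp add: field_simps)
      have "norm (u (Suc m) - u n) \<le> norm (u (Suc m) - u m) + norm (u m - u n)"
        using norm_triangle_ineq[of "u (Suc m) - u m" "u m - u n"] by simp
      also have "norm (u (Suc m) - u m) \<le> M * (2 * K * (1 / real m - 1 / real (Suc m)))"
        using \<open>\<And>m. m \<ge> 1 \<Longrightarrow> norm (u (Suc m) - u m) \<le> _\<close>[OF m] uM'[OF m] K nonneg
          mult_right_mono[OF uM'[OF m], of "2 * K * (1 / real m - 1 / real (Suc m))"]
        by (meson mult_nonneg_nonneg order_trans less_imp_le zero_le_numeral)
      finally show ?case using step.IH by (simp add: algebra_simps)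
    qed simp
    \<comment> \<open>Let \<open>m\<close> tend to infinity in \<open>tele\<close>.\<close>
    have lim: "norm (u n - rGamma y) \<le> 2 * K * M / real n"
    proof -
      have "(\<lambda>m. norm (u m - u n)) \<longlonglongrightarrow> norm (rGamma y - u n)"
        unfolding u_def by (intro tendsto_intros neg_binom_normalized_limit)
      moreover have "\<forall>\<^sub>F m in sequentially. norm (u m - u n) \<le> 2 * K * M / real n"
      proof (rule eventually_mono[OF eventually_ge_at_top[of n]])
        fix m assume m: "m \<ge> n"
        have "2 * K * M * (1 / real n - 1 / real m) \<le> 2 * K * M * (1 / real n)"
          using K M by (intro mult_left_mono) auto
        thus "norm (u m - u n) \<le> 2 * K * M / real n" using tele[OF m] by simp
      qed
      ultimately have "norm (rGamma y - u n) \<le> 2 * K * M / real n"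
        by (intro tendsto_upperbound) auto
      thus ?thesis by (simp add: norm_minus_commute)
    qed
    have npow: "norm ((of_nat n :: complex) powr (y - 1)) = real n powr (Re y - 1)"
      using n by (subst norm_powr_real_powr) auto
    have d: "neg_binom y n = u n * of_nat n powr (y - 1)"
    proof -
      have "(of_nat n :: complex) powr (1 - y) * of_nat n powr (y - 1) = 1"
        using n by (simp flip: powr_add)
      thus ?thesis by (simp add: u_def mult.assoc)
    qed
    have "norm (neg_binom y n) \<le> M * real n powr (Re y - 1)"
      unfolding d norm_mult npow using uM'[OF n] by (intro mult_right_mono) auto
    also have "\<dots> \<le> (M + 2 * K * M) * real n powr (Re y - 1)"
      using K M by (intro mult_right_mono) auto
    finally have 1: "norm (neg_binom y n) \<le> (M + 2 * K * M) * real n powr (Re y - 1)" .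
    have "neg_binom y n - rGamma y * of_nat n powr (y - 1) = (u n - rGamma y) * of_nat n powr (y - 1)"
      by (simp add: d ring_distribs)
    hence "norm (neg_binom y n - rGamma y * of_nat n powr (y - 1)) \<le>
          (2 * K * M / real n) * real n powr (Re y - 1)"
      using lim by (simp only: norm_mult npow) (intro mult_right_mono, auto)
    also have "\<dots> = 2 * K * M * real n powr (Re y - 2)"
    proof -
      have "real n powr (Re y - 1) = real n powr (Re y - 2) * real n"
        using n powr_add[of "real n" "Re y - 2" 1] by simp
      thus ?thesis using n by simp
    qed
    also have "\<dots> \<le> (M + 2 * K * M) * real n powr (Re y - 2)"
      using K M by (intro mult_right_mono) auto
    finally show ?thesis using 1 by blast
  qed
  moreover have "M + 2 * K * M > 0" using K M by (intro add_pos_pos mult_pos_pos) auto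
  ultimately show ?thesis by blast
qed

text \<open>If \<open>2 * k \<le> n\<close>, the shift is a sum of \<open>k\<close> consecutive
  differences at indices at least \<open>n / 2\<close>. Otherwise \<open>k\<close> is comparable to
  \<open>n\<close> and the trivial bound 2 suffices. The value 0 for \<open>k > n\<close> lets the
  convolution be treated as an infinite series.\<close>

lemma neg_binom_shift_bound:
  "\<exists>K>0. \<forall>y n k. norm y \<le> 1 \<longrightarrow> n \<ge> 1 \<longrightarrow>
     norm ((if k \<le> n then neg_binom y (n - k) else 0) - neg_binom y n)
       \<le> K * (real k + 1) ^ 3 * real n powr (Re y - 2)"
proof -
  obtain K0 where K0: "K0 > 0"
    and bound: "\<And>y n. norm y \<le> 1 \<Longrightarrow> n \<ge> 1 \<Longrightarrow> norm (neg_binom y n) \<le> K0 * real n powr (Re y - 1)"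
    using neg_binom_asymptotics by blast
  have "norm ((if k \<le> n then neg_binom y (n - k) else 0) - neg_binom y n)
       \<le> (16 * K0 + 16) * (real k + 1) ^ 3 * real n powr (Re y - 2)"
    if y: "norm y \<le> 1" and n: "n \<ge> 1" for y :: complex and n k :: nat
  proof (cases "2 * k \<le> n")
    case True
    define B where "B = 16 * K0 * real n powr (Re y - 2)"
    have Re: "Re y \<le> 1" "Re y \<ge> -1" using abs_Re_le_cmod[of y] y by auto
    have step: "norm (neg_binom y (Suc m) - neg_binom y m) \<le> B" if "2 * m \<ge> n" for m
    proof -
      have m: "m \<ge> 1" using that n by simp
      have "norm (neg_binom y m) * norm (y - 1) \<le> (K0 * real m powr (Re y - 1)) * 2"
        using bound[OF y m] norm_triangle_ineq4[of y 1] y K0 by (intro mult_mono) auto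
      hence "norm (neg_binom y (Suc m) - neg_binom y m) \<le> (K0 * real m powr (Re y - 1)) * 2 / real (Suc m)"
        unfolding neg_binom_diff norm_mult norm_divide norm_of_nat by (rule divide_right_mono) simp
      also have "\<dots> \<le> (K0 * real m powr (Re y - 1)) * 2 / real m"
        using m K0 by (intro divide_left_mono) auto
      also have "\<dots> = 2 * K0 * real m powr (Re y - 2)"
      proof -
        have "real m powr (Re y - 1) = real m powr (Re y - 2) * real m"
          using m powr_add[of "real m" "Re y - 2" 1] by simp
        thus ?thesis using m by simp
      qed
      \<comment> \<open>The exponent \<open>Re y - 2\<close> is negative, so passing from
        \<open>m\<close> to \<open>n / 2\<close> is allowed; the loss is
        \<open>2 powr (2 - Re y)\<close>, at most 8 because \<open>Re y \<ge> -1\<close>.\<close>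
      also have "\<dots> \<le> 2 * K0 * (8 * real n powr (Re y - 2))"
      proof (intro mult_left_mono)
        have "real m powr (Re y - 2) \<le> (real n / 2) powr (Re y - 2)"
          using that n Re by (intro powr_mono2') auto
        also have "\<dots> = 2 powr (2 - Re y) * real n powr (Re y - 2)"
        proof -
          have "2 powr (2 - Re y) = inverse (2 powr (Re y - 2))"
            by (simp flip: powr_minus)
          moreover have "(real n / 2) powr (Re y - 2) = real n powr (Re y - 2) / 2 powr (Re y - 2)"
            by (rule powr_divide)
          ultimately show ?thesis by (simp only: divide_inverse mult.commute)
        qed
        also have "\<dots> \<le> 2 powr 3 * real n powr (Re y - 2)"
          using Re by (intro mult_right_mono powr_mono) auto
        finally show "real m powr (Re y - 2) \<le> 8 * real n powr (Re y - 2)" by simp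
      qed (use K0 in auto)
      finally show ?thesis by (simp add: B_def)
    qed
    have "norm (neg_binom y (n - j) - neg_binom y n) \<le> real j * B" if "j \<le> k" for j
      using that
    proof (induction j)
      case (Suc j)
      have eq: "n - j = Suc (n - Suc j)" using Suc.prems True n by simp
      have "norm (neg_binom y (n - Suc j) - neg_binom y n) \<le>
            norm (neg_binom y (n - j) - neg_binom y (n - Suc j)) + norm (neg_binom y (n - j) - neg_binom y n)"
        using norm_triangle_ineq4[of "neg_binom y (n - j) - neg_binom y n" "neg_binom y (n - j) - neg_binom y (n - Suc j)"]
        by (simp add: algebra_simps)
      also have "norm (neg_binom y (n - j) - neg_binom y (n - Suc j)) \<le> B"
        unfolding eq using Suc.prems True by (intro step) simp
      finally show ?case using Suc by (simp add: algebra_simps)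
    qed simp
    from this[of k] have "norm (neg_binom y (n - k) - neg_binom y n) \<le> real k * B" by simp
    also have "\<dots> \<le> (real k + 1) ^ 3 * B"
    proof (intro mult_right_mono)
      have "real k + 1 \<le> (real k + 1) ^ 3" by (rule self_le_power) auto
      thus "real k \<le> (real k + 1) ^ 3" by linarith
    qed (use K0 in \<open>simp add: B_def\<close>)
    also have "\<dots> \<le> (16 * K0 + 16) * (real k + 1) ^ 3 * real n powr (Re y - 2)"
      by (simp add: B_def algebra_simps)
    finally show ?thesis using True by simp
  next
    case False
    have Re: "Re y \<ge> -1" using abs_Re_le_cmod[of y] y by auto
    have "norm ((if k \<le> n then neg_binom y (n - k) else 0) - neg_binom y n) \<le> 1 + 1"
      using norm_triangle_ineq4[of "if k \<le> n then neg_binom y (n - k) else 0" "neg_binom y n"]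
        norm_neg_binom_le_1[OF y, of n] norm_neg_binom_le_1[OF y, of "n - k"]
      by (auto split: if_splits)
    \<comment> \<open>Here \<open>n < 2 * k\<close>. The exponent 3 of \<open>k + 1\<close> is
      chosen because \<open>Re y - 2 \<ge> -3\<close>.\<close>
    also have "1 + 1 \<le> (16 * K0 + 16) * ((real k + 1) ^ 3 * real n powr (- 3))"
    proof -
      have "real n ^ 3 \<le> (2 * (real k + 1)) ^ 3" using False by (intro power_mono) auto
      also have "(2 * (real k + 1)) ^ 3 = 8 * (real k + 1) ^ 3" by (simp only: power_mult_distrib) simp
      finally have "1 \<le> 8 * ((real k + 1) ^ 3 * real n powr (- 3))"
        using n by (simp add: powr_minus powr_realpow[of _ 3, simplified] power_mult_distrib field_simps)
      moreover have "0 \<le> K0 * ((real k + 1) ^ 3 * real n powr (- 3))" using K0 by simp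
      ultimately show ?thesis by (simp add: ring_distribs)
    qed
    also have "\<dots> \<le> (16 * K0 + 16) * ((real k + 1) ^ 3 * real n powr (Re y - 2))"
      using Re K0 n by (intro mult_left_mono powr_mono) auto
    finally show ?thesis by (simp add: mult.assoc)
  qed
  moreover have "16 * K0 + 16 > 0" using K0 by simp
  ultimately show ?thesis by blast
qed

text \<open>The difference is the series of \<open>g k\<close> times the shift differences, and the
  previous bound is summed against \<open>norm (g k)\<close>. The cubic weight is the price of the
  shift.\<close>

lemma neg_binom_convolution_bound:
  "\<exists>K>0. \<forall>y n (g :: nat \<Rightarrow> complex). norm y \<le> 1 \<longrightarrow> n \<ge> 1 \<longrightarrow>
     summable (\<lambda>k. norm (g k) * (real k + 1) ^ 3) \<longrightarrow>
     norm ((\<Sum>k\<le>n. g k * neg_binom y (n - k)) - (\<Sum>k. g k) * neg_binom y n)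
       \<le> K * (\<Sum>k. norm (g k) * (real k + 1) ^ 3) * real n powr (Re y - 2)"
proof -
  obtain K where K: "K > 0" and
    bound: "\<And>y n k. norm y \<le> 1 \<Longrightarrow> n \<ge> 1 \<Longrightarrow>
     norm ((if k \<le> n then neg_binom y (n - k) else 0) - neg_binom y n)
       \<le> K * (real k + 1) ^ 3 * real n powr (Re y - 2)"
    using neg_binom_shift_bound by blast
  have "norm ((\<Sum>k\<le>n. g k * neg_binom y (n - k)) - (\<Sum>k. g k) * neg_binom y n)
       \<le> K * (\<Sum>k. norm (g k) * (real k + 1) ^ 3) * real n powr (Re y - 2)"
    if y: "norm y \<le> 1" and n: "n \<ge> 1" and sg: "summable (\<lambda>k. norm (g k) * (real k + 1) ^ 3)"
    for y :: complex and n :: nat and g :: "nat \<Rightarrow> complex"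
  proof -
    let ?P = "real n powr (Re y - 2)"
    define d where "d = (\<lambda>k. if k \<le> n then neg_binom y (n - k) else 0)"
    have "norm (g k) \<le> norm (g k) * (real k + 1) ^ 3" for k
      using mult_left_mono[of 1 "(real k + 1) ^ 3" "norm (g k)"] one_le_power[of "real k + 1" 3] by simp
    hence g: "summable g" by (intro summable_comparison_test[OF _ sg]) auto
    have d: "(\<lambda>k. g k * d k) sums (\<Sum>k\<le>n. g k * neg_binom y (n - k))"
      using sums_finite[of "{..n}" "\<lambda>k. g k * d k"] by (simp add: d_def)
    have "(\<lambda>k. g k * d k - g k * neg_binom y n) sums
        ((\<Sum>k\<le>n. g k * neg_binom y (n - k)) - (\<Sum>k. g k) * neg_binom y n)"
      by (intro sums_diff d sums_mult2 summable_sums g)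
    hence eq: "(\<Sum>k\<le>n. g k * neg_binom y (n - k)) - (\<Sum>k. g k) * neg_binom y n =
        (\<Sum>k. g k * (d k - neg_binom y n))"
      by (simp add: sums_iff ring_distribs)
    have sB: "summable (\<lambda>k. K * ?P * (norm (g k) * (real k + 1) ^ 3))"
      by (intro summable_mult sg)
    have le: "norm (g k * (d k - neg_binom y n)) \<le> K * ?P * (norm (g k) * (real k + 1) ^ 3)" for k
      using mult_left_mono[OF bound[OF y n, of k], of "norm (g k)"]
      by (simp add: d_def norm_mult mult_ac)
    have "norm (\<Sum>k. g k * (d k - neg_binom y n)) \<le> (\<Sum>k. K * ?P * (norm (g k) * (real k + 1) ^ 3))"
      using le sB by (intro norm_suminf_le) auto
    also have "\<dots> = K * (\<Sum>k. norm (g k) * (real k + 1) ^ 3) * ?P"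
      using sg by (subst suminf_mult) (auto simp: mult_ac)
    finally show ?thesis unfolding eq .
  qed
  thus ?thesis using K by blast
qed

lemma summable_polynomial_times_geometric:
  fixes x :: real
  assumes "0 \<le> x" "x < 1"
  shows "summable (\<lambda>k. (real k + 1) ^ m * x ^ k)"
proof (cases "x = 0")
  case False
  hence x: "0 < x" using assms by simp
  show ?thesis
  proof (rule summable_comparison_test_bigo)
    show "summable (\<lambda>k. norm (real k powr (-2)))"
      by (simp add: summable_real_powr_iff)
    show "(\<lambda>k. (real k + 1) ^ m * x ^ k) \<in> O(\<lambda>k. real k powr (-2))"
      using x assms by real_asymp
  qed
qed (auto simp: power_0_left split: if_splits intro!: summable_finite[of "{0}"])

subsection \<open>Power series with decaying logarithmic derivative\<close>

lemma choose_3_Suc: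
  "real (Suc k) * real ((Suc k + 3) choose 3) = (real k + 4) * real ((k + 3) choose 3)"
proof -
  have "k + 4 - 3 = Suc k" "k + 4 - 1 = k + 3" "k + 4 = Suc k + 3" by simp_all
  hence "Suc k * ((Suc k + 3) choose 3) = (k + 4) * ((k + 3) choose 3)"
    using binomial_absorb_comp[of "k + 4" 3] by metis
  hence "real (Suc k * ((Suc k + 3) choose 3)) = real ((k + 4) * ((k + 3) choose 3))"
    by (rule arg_cong)
  thus ?thesis by (simp only: of_nat_mult of_nat_add of_nat_numeral)
qed

lemma choose_3_le: "real ((k + 3) choose 3) \<le> (real k + 1) ^ 3"
proof (induction k)
  case (Suc k)
  have "real (Suc k) * real ((Suc k + 3) choose 3) = (real k + 4) * real ((k + 3) choose 3)"
    by (rule choose_3_Suc)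
  also have "\<dots> \<le> (real k + 4) * (real k + 1) ^ 3" using Suc by (intro mult_left_mono) auto
  also have "\<dots> \<le> (real k + 1) * (real k + 2) ^ 3"
    by (simp add: power3_eq_cube algebra_simps)
  finally show ?case by (simp add: mult_le_cancel_left_pos add.commute)
qed simp

text \<open>The logarithmic derivative identity for \<open>(1 - z) ^ (- 4)\<close>, whose
  coefficients are \<open>(k + 3) choose 3\<close>.\<close>

lemma choose_3_recurrence:
  "real k * real ((k + 3) choose 3) = 4 * (\<Sum>j\<in>{1..k}. real ((k - j + 3) choose 3))"
proof (induction k)
  case (Suc k)
  have "(\<Sum>j\<in>{1..Suc k}. real ((Suc k - j + 3) choose 3)) = (\<Sum>j\<in>{0..k}. real ((k - j + 3) choose 3))"
    using sum.shift_bounds_cl_Suc_ivl[of "\<lambda>j. real ((Suc k - j + 3) choose 3)" 0 k] by simp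
  also have "\<dots> = real ((k + 3) choose 3) + (\<Sum>j\<in>{1..k}. real ((k - j + 3) choose 3))"
    by (simp add: sum.atLeast_Suc_atMost)
  finally have "4 * (\<Sum>j\<in>{1..Suc k}. real ((Suc k - j + 3) choose 3)) = (real k + 4) * real ((k + 3) choose 3)"
    using Suc by (simp add: algebra_simps)
  thus ?case unfolding choose_3_Suc ..
qed simp

text \<open>The majorant is the coefficient sequence of \<open>(1 - r z)\<^sup>-\<^sup>4\<close>.\<close>

lemma norm_log_derivative_coeff_le:
  fixes e g :: "nat \<Rightarrow> complex"
  assumes e: "\<And>j. j \<ge> 1 \<Longrightarrow> norm (e j) \<le> 4 * r ^ j" and g0: "g 0 = 1" and r: "0 \<le> r"
    and rec: "\<And>k. of_nat k * g k = (\<Sum>j\<in>{1..k}. e j * g (k - j))"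
  shows "norm (g k) \<le> real ((k + 3) choose 3) * r ^ k"
proof (induction k rule: less_induct)
  case (less k)
  show ?case
  proof (cases "k = 0")
    case False
    have "real k * norm (g k) = norm (\<Sum>j\<in>{1..k}. e j * g (k - j))"
      by (subst rec[symmetric]) (simp add: norm_mult)
    also have "\<dots> \<le> (\<Sum>j\<in>{1..k}. (4 * r ^ j) * (real ((k - j + 3) choose 3) * r ^ (k - j)))"
    proof (intro sum_norm_le)
      fix j assume "j \<in> {1..k}"
      hence j: "j \<ge> 1" "k - j < k" by auto
      show "norm (e j * g (k - j)) \<le> (4 * r ^ j) * (real ((k - j + 3) choose 3) * r ^ (k - j))"
        unfolding norm_mult using e[OF j(1)] less[OF j(2)] r by (intro mult_mono) auto
    qed
    also have "\<dots> = (\<Sum>j\<in>{1..k}. 4 * real ((k - j + 3) choose 3) * r ^ k)"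
    proof (intro sum.cong refl)
      fix j assume "j \<in> {1..k}"
      hence "r ^ k = r ^ j * r ^ (k - j)" by (simp flip: power_add)
      thus "4 * r ^ j * (real (k - j + 3 choose 3) * r ^ (k - j)) = 4 * real (k - j + 3 choose 3) * r ^ k"
        by (simp add: mult_ac)
    qed
    also have "\<dots> = real k * (real ((k + 3) choose 3) * r ^ k)"
      using choose_3_recurrence[of k] by (simp add: sum_distrib_left sum_distrib_right flip: mult.assoc)
    finally show ?thesis using False by (simp add: mult_le_cancel_left_pos)
  qed (simp add: g0)
qed

text \<open>With \<open>E\<close> the series of \<open>e j / j\<close>, the recurrence says
  \<open>G' = E' * G\<close>. Both series converge in the disc of radius \<open>1 / r > 1\<close>,
  where \<open>G * exp (- E)\<close> has derivative 0 and equals 1 at the origin; evaluation at 1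
  gives the claim.\<close>

lemma suminf_eq_exp_of_recurrence:
  fixes e g :: "nat \<Rightarrow> complex"
  assumes e: "\<And>j. j \<ge> 1 \<Longrightarrow> norm (e j) \<le> 4 * r ^ j" and g0: "g 0 = 1" and r: "0 < r" "r < 1"
    and rec: "\<And>k. of_nat k * g k = (\<Sum>j\<in>{1..k}. e j * g (k - j))"
  shows "(\<Sum>k. g k) = exp (\<Sum>j. e j / of_nat j)"
proof -
  define E where "E = Abs_fps (\<lambda>j. e j / of_nat j)"
  define G where "G = Abs_fps g"
  have radE: "fps_conv_radius E \<ge> ereal (1 / r)"
    unfolding fps_conv_radius_def
  proof (rule conv_radius_geI_ex')
    fix s assume s: "0 < s" "ereal s < ereal (1 / r)"
    hence rs: "0 \<le> r * s" "r * s < 1" using r by (auto simp: field_simps)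
    show "summable (\<lambda>n. fps_nth E n * of_real s ^ n)"
    proof (rule summable_comparison_test)
      show "summable (\<lambda>n. 4 * (r * s) ^ n)" using rs by (intro summable_mult summable_geometric) auto
      have "norm (fps_nth E n * of_real s ^ n) \<le> 4 * (r * s) ^ n" for n
      proof (cases "n = 0")
        case False
        have "norm (e n) / real n \<le> norm (e n) / 1" using False by (intro divide_left_mono) auto
        also have "\<dots> \<le> 4 * r ^ n" using e[of n] False by simp
        finally have "norm (e n) / real n * s ^ n \<le> 4 * r ^ n * s ^ n"
          using s by (intro mult_right_mono) auto
        thus ?thesis using s by (simp add: E_def norm_mult norm_divide norm_power power_mult_distrib)
      qed (simp add: E_def)
      thus "\<exists>N. \<forall>n\<ge>N. norm (fps_nth E n * of_real s ^ n) \<le> 4 * (r * s) ^ n" by blast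
    qed
  qed
  have radG: "fps_conv_radius G \<ge> ereal (1 / r)"
    unfolding fps_conv_radius_def
  proof (rule conv_radius_geI_ex')
    fix s assume s: "0 < s" "ereal s < ereal (1 / r)"
    hence rs: "0 \<le> r * s" "r * s < 1" using r by (auto simp: field_simps)
    show "summable (\<lambda>n. fps_nth G n * of_real s ^ n)"
    proof (rule summable_comparison_test)
      show "summable (\<lambda>n. (real n + 1) ^ 3 * (r * s) ^ n)"
        by (rule summable_polynomial_times_geometric[OF rs])
      have "norm (fps_nth G n * of_real s ^ n) \<le> (real n + 1) ^ 3 * (r * s) ^ n" for n
      proof -
        have "norm (g n) \<le> (real n + 1) ^ 3 * r ^ n"
        proof -
          have "norm (g n) \<le> real ((n + 3) choose 3) * r ^ n"
            using e g0 less_imp_le[OF r(1)] rec by (rule norm_log_derivative_coeff_le)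
          also have "\<dots> \<le> (real n + 1) ^ 3 * r ^ n"
            using r by (intro mult_right_mono choose_3_le) auto
          finally show ?thesis .
        qed
        hence "norm (g n) * s ^ n \<le> (real n + 1) ^ 3 * r ^ n * s ^ n"
          using s by (intro mult_right_mono) auto
        thus ?thesis using s by (simp add: G_def norm_mult norm_power power_mult_distrib mult_ac)
      qed
      thus "\<exists>N. \<forall>n\<ge>N. norm (fps_nth G n * of_real s ^ n) \<le> (real n + 1) ^ 3 * (r * s) ^ n" by blast
    qed
  qed
  have ode: "fps_deriv G = fps_deriv E * G"
  proof (rule fps_ext)
    fix n
    have "fps_nth (fps_deriv E * G) n = (\<Sum>i\<in>{0..n}. e (Suc i) * g (n - i))"
      unfolding fps_mult_nth by (intro sum.cong refl) (simp add: E_def G_def del: of_nat_Suc)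
    also have "\<dots> = (\<Sum>j\<in>{1..Suc n}. e j * g (Suc n - j))"
      using sum.shift_bounds_cl_Suc_ivl[of "\<lambda>j. e j * g (Suc n - j)" 0 n] by simp
    also have "\<dots> = fps_nth (fps_deriv G) n"
      using rec[of "Suc n"] by (simp add: G_def)
    finally show "fps_nth (fps_deriv G) n = fps_nth (fps_deriv E * G) n" ..
  qed
  have "\<exists>c. \<forall>z\<in>ball 0 (1 / r). eval_fps G z * exp (- eval_fps E z) = c"
  proof (rule has_field_derivative_zero_constant)
    fix z :: complex assume "z \<in> ball 0 (1 / r)"
    hence z: "ereal (norm z) < ereal (1 / r)" by simp
    have zE: "norm z < fps_conv_radius E" and zG: "norm z < fps_conv_radius G"
      using less_le_trans[OF z radE] less_le_trans[OF z radG] by auto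
    have zE': "norm z < fps_conv_radius (fps_deriv E)"
      using less_le_trans[OF zE fps_conv_radius_deriv] .
    have "((\<lambda>z. eval_fps G z * exp (- eval_fps E z)) has_field_derivative
        eval_fps (fps_deriv G) z * exp (- eval_fps E z) +
        eval_fps G z * (exp (- eval_fps E z) * (- eval_fps (fps_deriv E) z))) (at z within ball 0 (1 / r))"
      by (rule derivative_eq_intros has_field_derivative_eval_fps[OF zE] has_field_derivative_eval_fps[OF zG] refl)+
         (simp add: algebra_simps)
    moreover have "eval_fps (fps_deriv G) z = eval_fps (fps_deriv E) z * eval_fps G z"
      unfolding ode by (rule eval_fps_mult[OF zE' zG])
    ultimately show "((\<lambda>z. eval_fps G z * exp (- eval_fps E z)) has_field_derivative 0) (at z within ball 0 (1 / r))"
      by (simp add: algebra_simps)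
  qed (rule convex_ball)
  then obtain c where c: "\<And>z. z \<in> ball 0 (1 / r) \<Longrightarrow> eval_fps G z * exp (- eval_fps E z) = c" by blast
  have "c = 1" using c[of 0] r by (simp add: eval_fps_at_0 G_def E_def g0)
  moreover have "eval_fps G 1 * exp (- eval_fps E 1) = c" using r by (intro c) (simp add: field_simps)
  ultimately have "eval_fps G 1 = exp (eval_fps E 1)" by (simp add: exp_minus field_simps)
  thus ?thesis by (simp add: eval_fps_def G_def E_def)
qed

section \<open>The correction factor \<open>kappa\<close>\<close>

lemma has_integral_inverse_square_shift:
  fixes a :: real
  assumes "a > 0"
  shows "((\<lambda>t. 1 / (a + t) ^ 2) has_integral 1 / a) {0..}"
proof (rule has_integral_to_inf)
  have int: "((\<lambda>t. 1 / (a + t) ^ 2) has_integral (- (1 / (a + y)) - - (1 / (a + 0)))) {0..y}" if "y \<ge> 0" for y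
  proof (rule fundamental_theorem_of_calculus[OF that])
    fix t assume "t \<in> {0..y}"
    hence "a + t \<noteq> 0" using assms by auto
    thus "((\<lambda>t. - (1 / (a + t))) has_vector_derivative 1 / (a + t) ^ 2) (at t within {0..y})"
      unfolding has_real_derivative_iff_has_vector_derivative[symmetric]
      by (auto intro!: derivative_eq_intros simp: power2_eq_square)
  qed
  show "(\<lambda>t. 1 / (a + t) ^ 2) integrable_on {0..y}" for y
  proof (cases "y \<ge> 0")
    case True
    thus ?thesis using int by blast
  qed (simp add: integrable_on_empty)
  have "((\<lambda>y. - (1 / (a + y)) - - (1 / (a + 0))) \<longlongrightarrow> 1 / a) at_top"
    using assms by real_asymp
  thus "((\<lambda>y. integral {0..y} (\<lambda>t. 1 / (a + t) ^ 2)) \<longlongrightarrow> 1 / a) at_top"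
    by (rule Lim_transform_eventually)
       (auto intro!: eventually_mono[OF eventually_ge_at_top[of 0]] integral_unique[symmetric] dest: int)
qed auto

text \<open>If the integrand is not integrable, the integral is 0 and the bound holds trivially.\<close>

lemma kappa_near_1:
  assumes y: "norm y \<le> 1" and n: "n > 2"
  shows "norm (kappa n y - 1) \<le> 9 / real n"
proof -
  let ?f = "\<lambda>t::real. complex_of_real (B1 t) / ((of_nat n - 1 + y + of_real t) * (of_nat n + of_real t))"
  let ?g = "\<lambda>t::real. 3 / 2 * (1 / (real n + t) ^ 2)"
  have g: "(?g has_integral 3 / 2 * (1 / real n)) {0..}"
    using n by (intro has_integral_mult_right has_integral_inverse_square_shift) auto
  have fg: "norm (?f t) \<le> ?g t" if t: "t \<in> {0..}" for t
  proof -
    have B1: "\<bar>B1 t\<bar> \<le> 1 / 2" unfolding B1_def by linarith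
    have nt: "norm (of_nat n + complex_of_real t) = real n + t"
    proof -
      have "of_nat n + complex_of_real t = of_real (real n + t)" by simp
      thus ?thesis using t by (simp only: norm_of_real abs_of_nonneg atLeast_iff of_nat_0_le_iff add_nonneg_nonneg)
    qed
    have "norm (of_nat n - 1 + y + complex_of_real t) \<ge> real n - 1 - 1 + t"
    proof -
      have "of_nat n - 1 + y + complex_of_real t = of_real (real n - 1 + t) - (- y)" by simp
      hence "norm (of_nat n - 1 + y + complex_of_real t) \<ge> norm (complex_of_real (real n - 1 + t)) - norm (- y)"
        by (simp only: norm_triangle_ineq2)
      thus ?thesis using y n t by (simp only: norm_of_real norm_minus_cancel)
    qed
    \<comment> \<open>This is where \<open>n \<ge> 3\<close> enters; equality holds at
      \<open>n = 3\<close>, \<open>t = 0\<close>.\<close>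
    also have "real n - 1 - 1 + t \<ge> (real n + t) / 3" using n t by (simp add: field_simps)
    finally have nyt: "norm (of_nat n - 1 + y + complex_of_real t) \<ge> (real n + t) / 3" .
    have "norm (?f t) = \<bar>B1 t\<bar> / (norm (of_nat n - 1 + y + complex_of_real t) * (real n + t))"
      by (simp only: norm_divide norm_mult nt norm_of_real)
    also have "\<dots> \<le> (1 / 2) / ((real n + t) / 3 * (real n + t))"
      using B1 nyt n t by (intro frac_le mult_right_mono mult_pos_pos) auto
    also have "\<dots> = ?g t" by (simp add: power2_eq_square)
    finally show ?thesis .
  qed
  have int: "norm (integral {0..} ?f) \<le> 3 / 2 * (1 / real n)"
  proof (cases "?f integrable_on {0..}")
    case True
    show ?thesis using integral_norm_bound_integral[OF True _ fg] g by (auto simp: has_integral_iff)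
  qed (simp add: not_integrable_integral)
  define w where "w = - (1 - y) * integral {0..} ?f"
  have "norm (1 - y) \<le> 2" using norm_triangle_ineq4[of 1 y] y by simp
  hence "norm w \<le> 2 * (3 / 2 * (1 / real n))"
    unfolding w_def norm_mult norm_minus_cancel using int by (intro mult_mono) auto
  hence w: "norm w \<le> 3 / real n" by simp
  also have "3 / real n \<le> 1" using n by simp
  finally have w1: "norm w \<le> 1" .
  have "norm (kappa n y - 1) = norm (exp w - 1)" by (simp add: kappa_def w_def)
  \<comment> \<open>The constant 9 is the product of \<open>exp 1 \<le> 3\<close> and
    \<open>norm w \<le> 3 / n\<close>.\<close>
  also have "\<dots> \<le> exp (norm w) * norm w" using Taylor_exp_field[of w 0] by simp
  also have "\<dots> \<le> 3 * (3 / real n)"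
  proof (intro mult_mono w)
    have "exp (norm w) \<le> exp 1" using w1 by simp
    thus "exp (norm w) \<le> 3" using exp_le by linarith
  qed auto
  finally show ?thesis by simp
qed

section \<open>Quotients of power series\<close>

text \<open>The sequence \<open>g\<close> consists of the coefficients of the quotient of the two
  generating functions; logarithmic derivatives subtract, hence the coefficients
  \<open>c j - b j\<close>.\<close>

lemma fps_quotient_recurrence:
  fixes a b c d :: "nat \<Rightarrow> complex"
  assumes a0: "a 0 = 1" and d0: "d 0 = 1"
    and a: "\<And>n. of_nat n * a n = (\<Sum>j\<in>{1..n}. c j * a (n - j))"
    and d: "\<And>n. of_nat n * d n = (\<Sum>j\<in>{1..n}. b j * d (n - j))"
  obtains g where "g 0 = 1" "\<And>n. a n = (\<Sum>k\<le>n. g k * d (n - k))"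
    "\<And>k. of_nat k * g k = (\<Sum>j\<in>{1..k}. (c j - b j) * g (k - j))"
proof -
  define F where "F = Abs_fps a"
  define D where "D = Abs_fps d"
  define G where "G = F * inverse D"
  \<comment> \<open>The coefficient at index 0 is set to 0 so that the Cauchy product starts at
    \<open>j = 1\<close>, as in the recurrences.\<close>
  define L where "L = (\<lambda>u :: nat \<Rightarrow> complex. Abs_fps (\<lambda>j. if j = 0 then 0 else u j))"
  have L_nth: "fps_nth (L u * H) n = (\<Sum>j\<in>{1..n}. u j * fps_nth H (n - j))" for u H n
    by (simp add: fps_mult_nth L_def sum.atLeast_Suc_atMost)
  have XD: "fps_nth (fps_X * fps_deriv H) n = of_nat n * fps_nth H n" for H :: "complex fps" and n
    by (cases n) auto
  have D0: "fps_nth D 0 \<noteq> 0" by (simp add: D_def d0)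
  hence Dnz: "D \<noteq> 0" by auto
  have FGD: "F = G * D" using D0 by (simp add: G_def mult.assoc inverse_mult_eq_1)
  have "fps_X * fps_deriv F = L c * F"
    by (rule fps_ext) (simp only: XD L_nth, simp add: F_def a)
  moreover have "fps_X * fps_deriv D = L b * D"
    by (rule fps_ext) (simp only: XD L_nth, simp add: D_def d)
  moreover have "fps_X * fps_deriv F = (fps_X * fps_deriv G) * D + G * (fps_X * fps_deriv D)"
    by (simp add: FGD algebra_simps)
  ultimately have "(fps_X * fps_deriv G) * D = (L c * G - L b * G) * D"
    by (simp add: FGD algebra_simps)
  hence ode: "fps_X * fps_deriv G = L c * G - L b * G" using Dnz by simp
  show thesis
  proof (rule that[of "fps_nth G"])
    have "fps_nth F 0 = fps_nth G 0 * fps_nth D 0" by (simp add: FGD)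
    thus "fps_nth G 0 = 1" by (simp add: F_def D_def a0 d0)
    show "a n = (\<Sum>k\<le>n. fps_nth G k * d (n - k))" for n
      using arg_cong[OF FGD, of "\<lambda>H. fps_nth H n"]
      by (simp add: F_def D_def fps_mult_nth atLeast0AtMost)
    show "of_nat k * fps_nth G k = (\<Sum>j\<in>{1..k}. (c j - b j) * fps_nth G (k - j))" for k
      using arg_cong[OF ode, of "\<lambda>H. fps_nth H k"]
      by (simp only: XD fps_sub_nth L_nth left_diff_distrib sum_subtractf)
  qed
qed

subsection \<open>The Euler product\<close>

lemma two_le_CARD_field: "CARD('a::{finite,field}) \<ge> 2"
proof -
  have "card {0, 1 :: 'a} \<le> CARD('a)" by (rule card_mono) auto
  thus ?thesis by simp
qed

text \<open>Those of degree exactly \<open>d\<close> contribute at most \<open>q ^ d\<close> by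
  \<open>irred_sum_1\<close>, and the geometric sum is at most twice its last term since
  \<open>q \<ge> 2\<close>.\<close>

lemma sum_degree_irreducibles_le:
  "(\<Sum>P\<in>{P\<in>(monic_irreducibles :: 'a::{finite,field} poly set). degree P \<le> m}. real (degree P))
     \<le> 2 * real CARD('a) ^ m"
proof -
  let ?I = "monic_irreducibles :: 'a poly set"
  let ?q = "real CARD('a)"
  have q: "?q \<ge> 2" using two_le_CARD_field[where 'a = 'a] by linarith
  have "(\<Sum>P\<in>{P\<in>?I. degree P \<le> m}. real (degree P)) =
        (\<Sum>d\<in>{..m}. \<Sum>P\<in>{P\<in>{P\<in>?I. degree P \<le> m}. degree P = d}. real (degree P))"
    by (rule sum.group[symmetric]) auto
  also have "\<dots> \<le> (\<Sum>d\<in>{..m}. ?q ^ d)"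
  proof (rule sum_mono)
    fix d assume d: "d \<in> {..m}"
    show "(\<Sum>P\<in>{P\<in>{P\<in>?I. degree P \<le> m}. degree P = d}. real (degree P)) \<le> ?q ^ d"
    proof (cases "d = 0")
      case True
      thus ?thesis by (auto intro!: order_trans[OF sum_nonpos])
    next
      case False
      have "(\<Sum>P\<in>{P\<in>{P\<in>?I. degree P \<le> m}. degree P = d}. real (degree P)) \<le>
            (\<Sum>P\<in>{P\<in>?I. degree P dvd d}. real (degree P))"
        using False by (intro sum_mono2 finite_monic_irreducibles_degree_dvd) auto
      also have "\<dots> = ?q ^ d"
      proof -
        have "complex_of_real (\<Sum>P\<in>{P\<in>?I. degree P dvd d}. real (degree P)) = irred_sum TYPE('a) 1 d"
          by (simp add: irred_sum_def)
        also have "\<dots> = complex_of_real (?q ^ d)" using irred_sum_1[of d "TYPE('a)"] False by simp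
        finally show ?thesis by (simp only: of_real_eq_iff)
      qed
      finally show ?thesis .
    qed
  qed
  also have "\<dots> \<le> 2 * ?q ^ m"
  proof (induction m)
    case (Suc m)
    have "2 * ?q ^ m \<le> ?q * ?q ^ m" using q by (intro mult_right_mono) auto
    moreover have "(\<Sum>d\<in>{..Suc m}. ?q ^ d) = (\<Sum>d\<in>{..m}. ?q ^ d) + ?q * ?q ^ m"
      "2 * ?q ^ Suc m = 2 * (?q * ?q ^ m)" by simp_all
    ultimately show ?case using Suc by linarith
  qed simp
  finally show ?thesis .
qed

text \<open>The share of \<open>P\<close> in \<open>c j / q ^ j - y\<close>; the main term
  \<open>y\<close> is distributed over the irreducibles by means of
  \<open>irred_sum_1\<close>.\<close>

definition log_factor_term :: "complex \<Rightarrow> nat \<Rightarrow> 'a::{finite,field} poly \<Rightarrow> complex" where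
  "log_factor_term y j P = of_nat (degree P) * (y ^ (j div degree P) - y) / of_nat CARD('a) ^ j"

text \<open>The terms with \<open>degree P = j\<close> vanish, so only degrees up to \<open>j / 2\<close> contribute.\<close>

lemma sum_norm_log_factor_term_le:
  assumes y: "norm y \<le> 1" and j: "j \<ge> 1"
  shows "(\<Sum>P\<in>{P\<in>(monic_irreducibles :: 'a::{finite,field} poly set). degree P dvd j}.
           norm (log_factor_term y j P)) \<le> 4 * (3 / 4) ^ j"
proof -
  let ?I = "monic_irreducibles :: 'a poly set"
  let ?q = "real CARD('a)"
  let ?S = "{P\<in>?I. degree P \<le> j div 2}"
  have q: "?q \<ge> 2" using two_le_CARD_field[where 'a = 'a] by linarith
  have "(\<Sum>P\<in>{P\<in>?I. degree P dvd j}. norm (log_factor_term y j P)) \<le>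
        (\<Sum>P\<in>{P\<in>?I. degree P dvd j}. if degree P \<le> j div 2 then 2 * real (degree P) / ?q ^ j else 0)"
  proof (rule sum_mono)
    fix P assume "P \<in> {P\<in>?I. degree P dvd j}"
    hence P: "P \<in> ?I" and "degree P dvd j" by auto
    then obtain k where k: "j = degree P * k" by blast
    have d: "degree P > 0" by (rule monic_irreducible_degree_pos[OF P])
    show "norm (log_factor_term y j P) \<le> (if degree P \<le> j div 2 then 2 * real (degree P) / ?q ^ j else 0)"
    proof (cases "k = 1")
      case True
      thus ?thesis using d by (simp add: log_factor_term_def k)
    next
      case False
      hence "k \<ge> 2" using k j by (cases k) auto
      hence "degree P * 2 \<le> j" unfolding k by (intro mult_le_mono2)
      hence "degree P \<le> j div 2" by simp
      moreover have "norm (y ^ (j div degree P) - y) \<le> 2"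
      proof -
        have "norm (y ^ (j div degree P)) \<le> 1" using y by (simp add: norm_power power_le_one)
        thus ?thesis using norm_triangle_ineq4[of "y ^ (j div degree P)" y] y by linarith
      qed
      hence "real (degree P) * norm (y ^ (j div degree P) - y) / ?q ^ j \<le> real (degree P) * 2 / ?q ^ j"
        by (intro divide_right_mono mult_left_mono) auto
      ultimately show ?thesis
        by (simp add: log_factor_term_def norm_mult norm_divide norm_power mult.commute)
    qed
  qed
  also have "\<dots> = (\<Sum>P\<in>{P\<in>{P\<in>?I. degree P dvd j}. degree P \<le> j div 2}. 2 * real (degree P) / ?q ^ j)"
    using j by (intro sum.inter_filter[symmetric] finite_monic_irreducibles_degree_dvd) auto
  also have "\<dots> \<le> (\<Sum>P\<in>?S. 2 * real (degree P) / ?q ^ j)"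
    by (intro sum_mono2) auto
  also have "\<dots> = 2 / ?q ^ j * (\<Sum>P\<in>?S. real (degree P))"
    by (simp add: sum_distrib_left)
  also have "\<dots> \<le> 2 / ?q ^ j * (2 * ?q ^ (j div 2))"
    using q by (intro mult_left_mono sum_degree_irreducibles_le) auto
  also have "\<dots> = 4 * (1 / ?q) ^ (j - j div 2)"
  proof -
    have "?q ^ j = ?q ^ (j - j div 2) * ?q ^ (j div 2)" by (simp flip: power_add)
    thus ?thesis using q by (simp add: power_divide)
  qed
  also have "\<dots> \<le> 4 * (1 / 2) ^ (j - j div 2)"
    using q by (intro mult_left_mono power_mono) (auto simp: field_simps)
  \<comment> \<open>The decay rate is \<open>1 / sqrt 2\<close>, and \<open>3 / 4\<close> is a
    convenient rational above it; squaring avoids the root and leaves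
    \<open>1 / 2 \<le> 9 / 16\<close>.\<close>
  also have "(1 / 2 :: real) ^ (j - j div 2) \<le> (3 / 4) ^ j"
  proof (rule power2_le_imp_le)
    have "((1 / 2 :: real) ^ (j - j div 2)) ^ 2 = (1 / 2) ^ (2 * (j - j div 2))"
      by (simp add: power_mult mult.commute flip: power_mult)
    also have "\<dots> \<le> (1 / 2) ^ j" by (intro power_decreasing) auto
    also have "\<dots> \<le> (9 / 16) ^ j" by (intro power_mono) auto
    also have "\<dots> = ((3 / 4) ^ j) ^ 2" by (simp add: power2_eq_square flip: power_mult_distrib)
    finally show "((1 / 2 :: real) ^ (j - j div 2)) ^ 2 \<le> ((3 / 4) ^ j) ^ 2" .
  qed simp
  finally show ?thesis by simp
qed

lemma irred_sum_minus_main_term: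
  assumes "j \<ge> 1"
  shows "irred_sum TYPE('a::{finite,field}) y j / of_nat CARD('a) ^ j - y =
    (\<Sum>P\<in>{P\<in>(monic_irreducibles :: 'a poly set). degree P dvd j}. log_factor_term y j P)"
proof -
  let ?q = "of_nat CARD('a) :: complex"
  have "(\<Sum>P\<in>{P\<in>(monic_irreducibles :: 'a poly set). degree P dvd j}. log_factor_term y j P) =
        (irred_sum TYPE('a) y j - y * irred_sum TYPE('a) 1 j) / ?q ^ j"
    by (simp add: log_factor_term_def irred_sum_def sum_divide_distrib sum_distrib_left
        sum_subtractf ring_distribs diff_divide_distrib mult_ac)
  also have "irred_sum TYPE('a) 1 j = ?q ^ j" using assms by (intro irred_sum_1) simp
  finally show ?thesis by (simp add: diff_divide_distrib)
qed

definition log_euler_factor :: "complex \<Rightarrow> 'a::{finite,field} poly \<Rightarrow> complex" where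
  "log_euler_factor y P = y * complex_of_real (ln (1 - 1 / poly_abs P)) - ln (1 - y / complex_of_real (poly_abs P))"

lemma poly_abs_ge_2:
  assumes "P \<in> (monic_irreducibles :: 'a::{finite,field} poly set)"
  shows "poly_abs P \<ge> 2"
proof -
  have q: "real CARD('a) \<ge> 2" using two_le_CARD_field[where 'a = 'a] by linarith
  have "real CARD('a) \<le> real CARD('a) ^ degree P"
    using monic_irreducible_degree_pos[OF assms] q by (intro self_le_power) auto
  also have "\<dots> = poly_abs P" using monic_irreducibles_nonzero[OF assms] by (simp add: poly_abs_def)
  finally show ?thesis using q by linarith
qed

lemma euler_factor_eq_exp:
  assumes P: "P \<in> (monic_irreducibles :: 'a::{finite,field} poly set)" and y: "norm y \<le> 1"
  shows "euler_factor y P = exp (log_euler_factor y P)"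
proof -
  have "norm (y / complex_of_real (poly_abs P)) \<le> 1 / 2"
    using poly_abs_ge_2[OF P] y by (auto simp: norm_divide intro!: frac_le)
  hence "1 - y / complex_of_real (poly_abs P) \<noteq> 0" by auto
  thus ?thesis by (simp add: euler_factor_def log_euler_factor_def exp_diff divide_inverse)
qed

text \<open>With \<open>x = 1 / poly_abs P\<close>, the expansion of both logarithms gives the terms
  \<open>(y ^ m - y) * x ^ m / m\<close>, and \<open>x ^ m\<close> is the reciprocal of
  \<open>q ^ (m * degree P)\<close>.\<close>

lemma log_euler_factor_has_sum:
  assumes P: "P \<in> (monic_irreducibles :: 'a::{finite,field} poly set)" and y: "norm y \<le> 1"
  shows "((\<lambda>m. log_factor_term y (m * degree P) P / of_nat (m * degree P)) has_sum log_euler_factor y P) {1..}"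
proof -
  define x where "x = 1 / poly_abs P"
  have x: "0 < x" "x \<le> 1 / 2"
    using poly_abs_ge_2[OF P] by (auto simp: x_def field_simps)
  have yx: "norm (y * of_real x) < 1"
    using mult_mono[OF y x(2)] x by (simp add: norm_mult)
  let ?t = "\<lambda>m. (y ^ m - y) * of_real x ^ m / of_nat m"
  have "(\<lambda>m. - ((y * of_real x) ^ m) / of_nat m) sums ln (1 - y * of_real x)"
    using Ln_series'[of "- (y * of_real x)"] yx by simp
  hence 1: "(\<lambda>m. - (- ((y * of_real x) ^ m) / of_nat m)) sums (- ln (1 - y * of_real x))"
    by (rule sums_minus)
  have "(\<lambda>m. - (complex_of_real x ^ m) / of_nat m) sums ln (1 - complex_of_real x)"
    using Ln_series'[of "- complex_of_real x"] x by simp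
  hence 2: "(\<lambda>m. y * (- (complex_of_real x ^ m) / of_nat m)) sums (y * ln (1 - complex_of_real x))"
    by (rule sums_mult)
  have "ln (1 - complex_of_real x) = complex_of_real (ln (1 - x))"
    using x Ln_of_real[of "1 - x"] by simp
  hence "(\<lambda>m. y * (- (complex_of_real x ^ m) / of_nat m) + - (- ((y * of_real x) ^ m) / of_nat m)) sums
           (y * of_real (ln (1 - x)) + - ln (1 - y * of_real x))"
    using sums_add[OF 2 1] by simp
  also have "(\<lambda>m. y * (- (complex_of_real x ^ m) / of_nat m) + - (- ((y * of_real x) ^ m) / of_nat m)) = ?t"
    by (auto simp: power_mult_distrib diff_divide_distrib left_diff_distrib)
  also have "y * of_real (ln (1 - x)) + - ln (1 - y * of_real x) = log_euler_factor y P"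
    by (simp add: log_euler_factor_def x_def divide_inverse)
  finally have sums: "?t sums log_euler_factor y P" .
  have "summable (\<lambda>m. norm (?t m))"
  proof (rule summable_comparison_test)
    show "summable (\<lambda>m. 2 * x ^ m)" using x by (intro summable_mult summable_geometric) auto
    have "norm (norm (?t m)) \<le> 2 * x ^ m" for m
    proof (cases "m = 0")
      case False
      have "norm (y ^ m) \<le> 1" using y by (simp add: norm_power power_le_one)
      hence y2: "norm (y ^ m - y) \<le> 2" using norm_triangle_ineq4[of "y ^ m" y] y by linarith
      have "norm (norm (?t m)) = norm (y ^ m - y) * x ^ m / real m"
        using x by (simp add: norm_mult norm_divide norm_power)
      also have "\<dots> \<le> 2 * x ^ m / 1"
        using x False y2 by (intro frac_le mult_right_mono) auto
      finally show ?thesis by simp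
    qed simp
    thus "\<exists>N. \<forall>m\<ge>N. norm (norm (?t m)) \<le> 2 * x ^ m" by blast
  qed
  hence "(?t has_sum log_euler_factor y P) UNIV" using sums by (rule norm_summable_imp_has_sum)
  \<comment> \<open>The term at \<open>m = 0\<close> is a division by 0 and thus has value
    0.\<close>
  hence "(?t has_sum log_euler_factor y P) {1..}"
    by (rule has_sum_cong_neutral[THEN iffD1, rotated -1]) auto
  moreover have "log_factor_term y (m * degree P) P / of_nat (m * degree P) = ?t m" if "m \<in> {1..}" for m
    using that monic_irreducible_degree_pos[OF P] monic_irreducibles_nonzero[OF P]
    by (simp add: log_factor_term_def x_def poly_abs_def power_divide power_mult mult.commute flip: power_mult)
  ultimately show ?thesis by (subst has_sum_cong) auto
qed

lemma unordered_prodI: "has_unordered_prod g S l \<Longrightarrow> unordered_prod g S = l"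
  unfolding unordered_prod_def has_unordered_prod_def
  by (rule the_equality) (auto intro: tendsto_unique[OF finite_subsets_at_top_neq_bot])

text \<open>Continuity of \<open>exp\<close> carries the limit of the finite sums to the finite
  products along the same filter.\<close>

lemma unordered_prod_exp:
  assumes "(f has_sum s) S" and "\<And>x. x \<in> S \<Longrightarrow> g x = exp (f x)"
  shows "unordered_prod g S = exp s"
proof (rule unordered_prodI, unfold has_unordered_prod_def)
  have "((\<lambda>F. exp (\<Sum>x\<in>F. f x)) \<longlongrightarrow> exp s) (finite_subsets_at_top S)"
    using assms(1) unfolding has_sum_def by (intro tendsto_intros)
  moreover have "\<forall>\<^sub>F F in finite_subsets_at_top S. exp (\<Sum>x\<in>F. f x) = (\<Prod>x\<in>F. g x)"
    by (rule eventually_finite_subsets_at_top_weakI) (auto simp: exp_sum assms(2) intro!: prod.cong)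
  ultimately show "((\<lambda>F. \<Prod>x\<in>F. g x) \<longlongrightarrow> exp s) (finite_subsets_at_top S)"
    by (rule Lim_transform_eventually)
qed

text \<open>The double family \<open>h\<close> is summed in two orders. Fixing \<open>j\<close> and
  summing over \<open>P\<close> gives \<open>e j / j\<close>; fixing \<open>P\<close> and summing
  over the multiples \<open>j\<close> of \<open>degree P\<close> gives the logarithm of the Euler
  factor.\<close>

lemma euler_product_eq:
  fixes y :: complex
  assumes y: "norm y \<le> 1"
  defines "e \<equiv> \<lambda>j. irred_sum TYPE('a::{finite,field}) y j / of_nat CARD('a) ^ j - y"
  shows "unordered_prod (euler_factor y) (monic_irreducibles :: 'a poly set) = exp (\<Sum>j. e j / of_nat j)"
proof -
  let ?I = "monic_irreducibles :: 'a poly set"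
  let ?D = "\<lambda>j. {P\<in>?I. degree P dvd j}"
  define h where "h = (\<lambda>(j, P :: 'a poly). log_factor_term y j P / of_nat j)"
  have finD: "finite (?D j)" if "j \<in> {1..}" for j
    using that finite_monic_irreducibles_degree_dvd[of j] by simp
  \<comment> \<open>Absolute summability, from the geometric bound on the inner sums, justifies the
    exchange of the two orders.\<close>
  have "(\<lambda>x. norm (h x)) summable_on Sigma {1..} ?D"
    unfolding Infinite_Sum.abs_summable_on_Sigma_iff
  proof (intro conjI ballI)
    fix j :: nat assume "j \<in> {1..}"
    thus "(\<lambda>P. norm (h (j, P))) summable_on ?D j" using finD by (intro summable_on_finite)
  next
    have "(\<lambda>j. 4 * (3 / 4 :: real) ^ j) summable_on UNIV"
      by (intro norm_summable_imp_summable_on) (auto intro!: summable_mult)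
    hence geo: "(\<lambda>j. 4 * (3 / 4 :: real) ^ j) summable_on {1..}"
      by (rule summable_on_subset_banach) simp
    show "(\<lambda>j. norm (\<Sum>\<^sub>\<infinity>P\<in>?D j. norm (h (j, P)))) summable_on {1..}"
    proof (rule Infinite_Sum.abs_summable_on_comparison_test'[OF geo])
      fix j :: nat assume j: "j \<in> {1..}"
      have "norm (\<Sum>\<^sub>\<infinity>P\<in>?D j. norm (h (j, P))) = (\<Sum>P\<in>?D j. norm (log_factor_term y j P) / real j)"
        using finD[OF j] by (simp add: h_def norm_divide sum_nonneg)
      also have "\<dots> \<le> (\<Sum>P\<in>?D j. norm (log_factor_term y j P) / 1)"
        using j by (intro sum_mono divide_left_mono) auto
      also have "\<dots> \<le> 4 * (3 / 4) ^ j"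
        using sum_norm_log_factor_term_le[OF y, of j] j by simp
      finally show "norm (\<Sum>\<^sub>\<infinity>P\<in>?D j. norm (h (j, P))) \<le> 4 * (3 / 4) ^ j" .
    qed
  qed
  hence "h summable_on Sigma {1..} ?D" by (rule Infinite_Sum.abs_summable_summable)
  then obtain S where S: "(h has_sum S) (Sigma {1..} ?D)" by (auto simp: summable_on_def)
  have "((\<lambda>j. e j / of_nat j) has_sum S) {1..}"
  proof (rule has_sum_SigmaD[OF S])
    fix j :: nat assume j: "j \<in> {1..}"
    have "e j / of_nat j = (\<Sum>P\<in>?D j. h (j, P))"
      using irred_sum_minus_main_term[of j y, where 'a = 'a] j
      by (simp add: e_def h_def sum_divide_distrib)
    thus "((\<lambda>P. h (j, P)) has_sum e j / of_nat j) (?D j)"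
      using finD[OF j] by (simp add: has_sum_finite)
  qed
  \<comment> \<open>Index 0 may be added, since the quotient \<open>e 0 / 0\<close> is 0.\<close>
  hence "((\<lambda>j. e j / of_nat j) has_sum S) UNIV"
    by (rule has_sum_cong_neutral[THEN iffD1, rotated -1]) auto
  hence "(\<lambda>j. e j / of_nat j) sums S" by (rule has_sum_imp_sums)
  hence sumS: "(\<Sum>j. e j / of_nat j) = S" by (simp add: sums_iff)
  \<comment> \<open>The pairs \<open>(j, P)\<close> with \<open>degree P dvd j\<close> are exactly
    the \<open>(m * degree P, P)\<close> with \<open>m \<ge> 1\<close>.\<close>
  have "((\<lambda>(P, m). h (m * degree P, P)) has_sum S) (Sigma ?I (\<lambda>_. {1..})) =
        (h has_sum S) (Sigma {1..} ?D)"
  proof (rule has_sum_reindex_bij_witness[where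
      i = "\<lambda>(j, P). (P, j div degree P)" and j = "\<lambda>(P, m). (m * degree P, P)"])
    fix x assume x: "x \<in> Sigma ?I (\<lambda>_. {1::nat..})"
    then obtain P m where Pm: "x = (P, m)" "P \<in> ?I" "m \<ge> 1" by auto
    have "degree P > 0" by (rule monic_irreducible_degree_pos[OF Pm(2)])
    thus "(\<lambda>(j, P). (P, j div degree P)) ((\<lambda>(P, m). (m * degree P, P)) x) = x"
      "(\<lambda>(P, m). (m * degree P, P)) x \<in> Sigma {1..} ?D"
      "h ((\<lambda>(P, m). (m * degree P, P)) x) = (case x of (P, m) \<Rightarrow> h (m * degree P, P))"
      using Pm by auto
  next
    fix b assume "b \<in> Sigma {1..} ?D"
    then obtain j P where b: "b = (j, P)" "j \<ge> 1" "P \<in> ?I" "degree P dvd j" by auto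
    have "j div degree P \<ge> 1"
      using b monic_irreducible_degree_pos[OF b(3)] by (auto elim!: dvdE simp: Suc_le_eq)
    thus "(\<lambda>(P, m). (m * degree P, P)) ((\<lambda>(j, P). (P, j div degree P)) b) = b"
      "(\<lambda>(j, P). (P, j div degree P)) b \<in> Sigma ?I (\<lambda>_. {1..})"
      using b by auto
  qed simp
  with S have "((\<lambda>(P, m). h (m * degree P, P)) has_sum S) (Sigma ?I (\<lambda>_. {1..}))" by simp
  hence "(log_euler_factor y has_sum S) ?I"
  proof (rule has_sum_SigmaD)
    fix P assume "P \<in> ?I"
    from log_euler_factor_has_sum[OF this y]
    show "((\<lambda>m. case (P, m) of (P, m) \<Rightarrow> h (m * degree P, P)) has_sum log_euler_factor y P) {1..}"
      by (simp add: h_def)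
  qed
  hence "unordered_prod (euler_factor y) ?I = exp S"
    by (rule unordered_prod_exp) (rule euler_factor_eq_exp[OF _ y])
  thus ?thesis by (simp add: sumS)
qed

section \<open>Assembling the asymptotic formula\<close>

text \<open>Here \<open>g\<close> is the coefficient sequence of the generating function of
  \<open>a n\<close> divided by \<open>(1 - z) ^ (- y)\<close>, and its value at 1 is the Euler
  product. The bound on \<open>g\<close> is the same for all \<open>y\<close>, which makes the final
  constant uniform.\<close>

lemma Omega_sum_decomposition:
  fixes y :: complex
  assumes y: "norm y \<le> 1"
  obtains g where
    "\<And>k. norm (g k) \<le> (real k + 1) ^ 3 * (3 / 4) ^ k"
    "\<And>n. Omega_sum TYPE('a::{finite,field}) y n = of_nat CARD('a) ^ n * (\<Sum>k\<le>n. g k * neg_binom y (n - k))"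
    "unordered_prod (euler_factor y) (monic_irreducibles :: 'a poly set) = (\<Sum>k. g k)"
proof -
  let ?q = "of_nat CARD('a) :: complex"
  define a where "a = (\<lambda>n. Omega_sum TYPE('a) y n / ?q ^ n)"
  define c where "c = (\<lambda>j. irred_sum TYPE('a) y j / ?q ^ j)"
  have q: "?q \<noteq> 0" by simp
  have rec: "of_nat n * a n = (\<Sum>j\<in>{1..n}. c j * a (n - j))" for n
  proof -
    have "of_nat n * a n = (\<Sum>j\<in>{1..n}. irred_sum TYPE('a) y j * Omega_sum TYPE('a) y (n - j) / ?q ^ n)"
      using Omega_sum_recurrence[of n "TYPE('a)" y] by (simp add: a_def sum_divide_distrib)
    also have "\<dots> = (\<Sum>j\<in>{1..n}. c j * a (n - j))"
    proof (intro sum.cong refl)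
      fix j assume "j \<in> {1..n}"
      hence "?q ^ n = ?q ^ j * ?q ^ (n - j)" by (simp flip: power_add)
      thus "irred_sum TYPE('a) y j * Omega_sum TYPE('a) y (n - j) / ?q ^ n = c j * a (n - j)"
        by (simp add: a_def c_def)
    qed
    finally show ?thesis .
  qed
  obtain g where g0: "g 0 = 1" and ag: "\<And>n. a n = (\<Sum>k\<le>n. g k * neg_binom y (n - k))"
    and grec: "\<And>k. of_nat k * g k = (\<Sum>j\<in>{1..k}. (c j - y) * g (k - j))"
  proof -
    have "a 0 = 1" by (simp add: a_def Omega_sum_0)
    moreover have "of_nat n * neg_binom y n = (\<Sum>j\<in>{1..n}. y * neg_binom y (n - j))" for n
      by (simp add: neg_binom_sum sum_distrib_left)
    ultimately show ?thesis
      using fps_quotient_recurrence[of a "neg_binom y" c "\<lambda>_. y"] rec that neg_binom_0 by blast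
  qed
  have e: "norm (c j - y) \<le> 4 * (3 / 4) ^ j" if "j \<ge> 1" for j
  proof -
    have "norm (c j - y) \<le>
        (\<Sum>P\<in>{P\<in>(monic_irreducibles :: 'a poly set). degree P dvd j}. norm (log_factor_term y j P))"
      unfolding c_def irred_sum_minus_main_term[OF that] by (rule norm_sum)
    thus ?thesis using sum_norm_log_factor_term_le[OF y that, where 'a = 'a] by linarith
  qed
  show thesis
  proof (rule that[of g])
    fix k
    have "norm (g k) \<le> real ((k + 3) choose 3) * (3 / 4) ^ k"
      by (rule norm_log_derivative_coeff_le[of "\<lambda>j. c j - y"]) (use e g0 grec in auto)
    also have "\<dots> \<le> (real k + 1) ^ 3 * (3 / 4) ^ k"
      by (intro mult_right_mono choose_3_le) auto
    finally show "norm (g k) \<le> (real k + 1) ^ 3 * (3 / 4) ^ k" .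
  next
    fix n
    have "Omega_sum TYPE('a) y n = ?q ^ n * a n" by (simp add: a_def)
    thus "Omega_sum TYPE('a) y n = ?q ^ n * (\<Sum>k\<le>n. g k * neg_binom y (n - k))" by (simp only: ag)
  next
    have "(\<Sum>k. g k) = exp (\<Sum>j. (c j - y) / of_nat j)"
      by (rule suminf_eq_exp_of_recurrence[of _ "3 / 4"]) (use e g0 grec in auto)
    thus "unordered_prod (euler_factor y) (monic_irreducibles :: 'a poly set) = (\<Sum>k. g k)"
      using euler_product_eq[OF y, where 'a = 'a] by (simp add: c_def)
  qed
qed

theorem theorem3p3:
  fixes \<rho> :: real
  assumes "0 < \<rho>" and "\<rho> < 1"
  shows "\<exists>C::real. \<forall>y::complex. \<forall>n::nat. norm y \<le> \<rho> \<longrightarrow> n > 2 \<longrightarrow>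
    norm ((\<Sum>f\<in>(monic_of_degree n :: 'a::{finite,field} poly set). y ^ big_Omega f) -
          unordered_prod (euler_factor y) (monic_irreducibles :: 'a poly set) *
          (kappa n y * of_nat CARD('a) ^ n * rGamma y / of_nat n powr (1 - y)))
      \<le> C * (real CARD('a) ^ n / real n powr (2 - Re y))"
proof -
  let ?q = "of_nat CARD('a) :: complex"
  obtain K1 where K1: "K1 > 0" and conv: "\<And>y n (g :: nat \<Rightarrow> complex). norm y \<le> 1 \<Longrightarrow> n \<ge> 1 \<Longrightarrow>
     summable (\<lambda>k. norm (g k) * (real k + 1) ^ 3) \<Longrightarrow>
     norm ((\<Sum>k\<le>n. g k * neg_binom y (n - k)) - (\<Sum>k. g k) * neg_binom y n)
       \<le> K1 * (\<Sum>k. norm (g k) * (real k + 1) ^ 3) * real n powr (Re y - 2)"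
    using neg_binom_convolution_bound by blast
  obtain K where K: "K > 0"
    and d1: "\<And>y n. norm y \<le> 1 \<Longrightarrow> n \<ge> 1 \<Longrightarrow> norm (neg_binom y n) \<le> K * real n powr (Re y - 1)"
    and d2: "\<And>y n. norm y \<le> 1 \<Longrightarrow> n \<ge> 1 \<Longrightarrow>
      norm (neg_binom y n - rGamma y * of_nat n powr (y - 1)) \<le> K * real n powr (Re y - 2)"
    using neg_binom_asymptotics by blast
  \<comment> \<open>The exponent 6 combines the cubic factor in the bound on \<open>g\<close> with
    the cubic weight in the convolution bound.\<close>
  define S where "S = (\<Sum>k. (real k + 1) ^ 6 * (3 / 4) ^ k)"
  have summS: "summable (\<lambda>k. (real k + 1) ^ 6 * (3 / 4) ^ k)"
    by (rule summable_polynomial_times_geometric) auto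
  \<comment> \<open>One summand for each replacement: the convolution by
    \<open>H * neg_binom y n\<close>, then \<open>neg_binom y n\<close> by its asymptotic value
    \<open>w\<close>, and finally \<open>kappa n y\<close> by 1.\<close>
  define C where "C = K1 * S + S * K + S * (2 * K * 9)"
  have "norm ((\<Sum>f\<in>(monic_of_degree n :: 'a poly set). y ^ big_Omega f) -
          unordered_prod (euler_factor y) (monic_irreducibles :: 'a poly set) *
          (kappa n y * ?q ^ n * rGamma y / of_nat n powr (1 - y)))
      \<le> C * (real CARD('a) ^ n / real n powr (2 - Re y))"
    if y\<rho>: "norm y \<le> \<rho>" and n: "n > 2" for y n
  proof -
    let ?N = "real n powr (Re y - 2)"
    have y: "norm y \<le> 1" using y\<rho> assms by simp
    have n1: "n \<ge> 1" using n by simp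
    obtain g where g: "\<And>k. norm (g k) \<le> (real k + 1) ^ 3 * (3 / 4) ^ k"
      and Og: "\<And>n. Omega_sum TYPE('a) y n = ?q ^ n * (\<Sum>k\<le>n. g k * neg_binom y (n - k))"
      and prod: "unordered_prod (euler_factor y) (monic_irreducibles :: 'a poly set) = (\<Sum>k. g k)"
      using Omega_sum_decomposition[OF y] by blast
    have gk: "norm (g k) * (real k + 1) ^ 3 \<le> (real k + 1) ^ 6 * (3 / 4) ^ k" for k
    proof -
      have "norm (g k) * (real k + 1) ^ 3 \<le> (real k + 1) ^ 3 * (3 / 4) ^ k * (real k + 1) ^ 3"
        by (intro mult_right_mono g) auto
      also have "\<dots> = ((real k + 1) ^ 3 * (real k + 1) ^ 3) * (3 / 4) ^ k" by (simp only: mult_ac)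
      finally show ?thesis by (simp only: power_add[symmetric]) simp
    qed
    have summg: "summable (\<lambda>k. norm (g k) * (real k + 1) ^ 3)"
      by (rule summable_comparison_test[OF _ summS]) (use gk in auto)
    have sumg: "(\<Sum>k. norm (g k) * (real k + 1) ^ 3) \<le> S"
      unfolding S_def by (intro suminf_le gk summg summS)
    define H where "H = (\<Sum>k. g k)"
    have H: "norm H \<le> S"
    proof -
      have "norm (g k) \<le> norm (g k) * (real k + 1) ^ 3" for k
        using mult_left_mono[of 1 "(real k + 1) ^ 3" "norm (g k)"] one_le_power[of "real k + 1" 3] by simp
      hence "norm H \<le> (\<Sum>k. norm (g k) * (real k + 1) ^ 3)"
        unfolding H_def by (intro norm_suminf_le summg)
      thus ?thesis using sumg by linarith
    qed
    have S: "S \<ge> 0" using H norm_ge_zero[of H] by linarith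
    define w where "w = rGamma y * of_nat n powr (y - 1)"
    define A where "A = (\<Sum>k\<le>n. g k * neg_binom y (n - k))"
    have inv: "1 / (of_nat n :: complex) powr (1 - y) = of_nat n powr (y - 1)"
      using powr_minus[of "of_nat n :: complex" "1 - y"] by (simp add: divide_inverse)
    have shift: "real n powr (Re y - 1) = real n * ?N"
      using n powr_add[of "real n" 1 "Re y - 2"] by simp
    have 1: "norm (A - H * neg_binom y n) \<le> K1 * S * ?N"
    proof -
      have "norm (A - H * neg_binom y n) \<le> K1 * (\<Sum>k. norm (g k) * (real k + 1) ^ 3) * ?N"
        unfolding A_def H_def by (rule conv[OF y n1 summg])
      also have "\<dots> \<le> K1 * S * ?N" using K1 sumg by (intro mult_right_mono mult_left_mono) auto
      finally show ?thesis .
    qed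
    have 2: "norm (H * (neg_binom y n - w)) \<le> S * (K * ?N)"
      unfolding norm_mult w_def using d2[OF y n1] H S by (intro mult_mono) auto
    \<comment> \<open>Comparison with \<open>neg_binom y n\<close> bounds \<open>w\<close> uniformly
      in \<open>y\<close> without a separate estimate of \<open>rGamma y\<close>.\<close>
    have w: "norm w \<le> 2 * K * real n powr (Re y - 1)"
    proof -
      have "norm w \<le> norm (neg_binom y n) + norm (neg_binom y n - w)"
        using norm_triangle_ineq4[of "neg_binom y n" "neg_binom y n - w"] by simp
      also have "\<dots> \<le> K * real n powr (Re y - 1) + K * real n powr (Re y - 2)"
        using d1[OF y n1] d2[OF y n1] unfolding w_def by (rule add_mono)
      also have "K * real n powr (Re y - 2) \<le> K * real n powr (Re y - 1)"
        using K n by (intro mult_left_mono powr_mono) auto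
      finally show ?thesis by simp
    qed
    \<comment> \<open>The factor \<open>9 / n\<close> from \<open>kappa_near_1\<close> lowers the
      exponent from \<open>Re y - 1\<close> to \<open>Re y - 2\<close>.\<close>
    have 3: "norm (H * (w * (1 - kappa n y))) \<le> S * (2 * K * 9 * ?N)"
    proof -
      have "norm (w * (1 - kappa n y)) \<le> (2 * K * real n powr (Re y - 1)) * (9 / real n)"
        unfolding norm_mult using w kappa_near_1[OF y n] K by (intro mult_mono) (auto simp: norm_minus_commute)
      also have "\<dots> = 2 * K * 9 * ?N" using n by (simp add: shift)
      finally show ?thesis unfolding norm_mult[of H] using H S by (intro mult_mono) auto
    qed
    have "(\<Sum>f\<in>(monic_of_degree n :: 'a poly set). y ^ big_Omega f) = ?q ^ n * A"
      using Og[of n] by (simp add: Omega_sum_def A_def)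
    moreover have "kappa n y * ?q ^ n * rGamma y / of_nat n powr (1 - y) = ?q ^ n * (kappa n y * w)"
    proof -
      have "kappa n y * ?q ^ n * rGamma y / of_nat n powr (1 - y) =
            ?q ^ n * (kappa n y * (rGamma y * (1 / of_nat n powr (1 - y))))" by simp
      thus ?thesis unfolding inv w_def .
    qed
    ultimately have "(\<Sum>f\<in>(monic_of_degree n :: 'a poly set). y ^ big_Omega f) -
          unordered_prod (euler_factor y) (monic_irreducibles :: 'a poly set) *
          (kappa n y * ?q ^ n * rGamma y / of_nat n powr (1 - y)) =
        ?q ^ n * (A - H * neg_binom y n + H * (neg_binom y n - w) + H * (w * (1 - kappa n y)))"
      by (simp add: prod H_def algebra_simps)
    also have "norm \<dots> \<le> real CARD('a) ^ n * (K1 * S * ?N + S * (K * ?N) + S * (2 * K * 9 * ?N))"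
      unfolding norm_mult norm_power norm_of_nat
      by (intro mult_left_mono norm_triangle_le add_mono 1 2 3) auto
    also have "\<dots> = C * (real CARD('a) ^ n / real n powr (2 - Re y))"
    proof -
      have "?N = 1 / real n powr (2 - Re y)"
        using powr_minus[of "real n" "2 - Re y"] by (simp add: divide_inverse)
      thus ?thesis by (simp add: C_def algebra_simps add_divide_distrib)
    qed
    finally show ?thesis .
  qed
  thus ?thesis by blast
qed

end
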